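(* Let $\sigma$ be a layered permutation with layers of sizes $(\ell_1,\dots,\ell_k)$, $k\ge 2$. If $\ell_1=\ell_k\ge 2$ and for every $i\in[k-1]$ at least one of $\ell_i,\ell_{i+1}$ equals $\ell_1$, then there exists an integer $K\in\mathbb{N}$ such that every $\sigma$-optimal layered permutation has at most $K$ layers.
   Context: A permutation of order $n$ is a bijection $\pi:[n]\to[n]$; the density $d(\sigma,\pi)$ of $\sigma$ in $\pi$ (for $|\pi|\ge|\sigma|$) is the probability that $|\sigma|$ uniformly random distinct positions $i_1<\cdots<i_{|\sigma|}$ of $\pi$ induce $\sigma$, i.e. $\pi(i_j)<\pi(i_{j'})$ iff $\sigma(j)<\sigma(j')$. A permutation $\sigma$ of order $m$ is layered with layers of sizes $(\ell_1,\ldots,\ell_k)$ if $[m]$ is partitioned into consecutive intervals $I_1,\ldots,I_k$ (in order) with $|I_j|=\ell_j$, $\sigma$ decreasing on each $I_j$, and $\sigma(x)<\sigma(x')$ for $x\in I_j,x'\in I_{j'}$, $j<j'$. A permutation $\pi$ with $|\pi|\ge|\sigma|$ is $\sigma$-optimal if $d(\sigma,\pi)\ge d(\sigma,\pi')$ for every permutation $\pi'$ of order $|\pi|$. *)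

theory Defs
  imports Complex_Main "HOL-Library.FuncSet" "HOL-Combinatorics.Permutations"
begin

text \<open>A permutation of order \<open>n\<close> is a function \<open>p\<close> with \<open>p permutes {1..n}\<close>. Such a function is
  the identity outside \<open>{1..n}\<close> and does not determine \<open>n\<close>, so the order is always
  passed as a separate argument.\<close>

text \<open>The choices of \<open>m\<close> positions \<open>i 1 < \<dots> < i m\<close> in \<open>{1..n}\<close>; extensionality makes each choice
  be counted exactly once.\<close>

definition position_choices :: "nat \<Rightarrow> nat \<Rightarrow> (nat \<Rightarrow> nat) set" where
  "position_choices m n = {i \<in> {1..m} \<rightarrow>\<^sub>E {1..n}. strict_mono_on {1..m} i}"

definition induces :: "nat \<Rightarrow> (nat \<Rightarrow> nat) \<Rightarrow> (nat \<Rightarrow> nat) \<Rightarrow> (nat \<Rightarrow> nat) \<Rightarrow> bool" where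
  "induces m \<sigma> \<pi> i \<longleftrightarrow> (\<forall>j\<in>{1..m}. \<forall>j'\<in>{1..m}. \<pi> (i j) < \<pi> (i j') \<longleftrightarrow> \<sigma> j < \<sigma> j')"

text \<open>Density of \<open>\<sigma>\<close> (of order \<open>m\<close>) in \<open>\<pi>\<close> (of order \<open>n\<close>), as the probability under the uniform
  distribution on \<open>position_choices m n\<close>. It is only meaningful for \<open>m \<le> n\<close>.\<close>

definition perm_density :: "nat \<Rightarrow> (nat \<Rightarrow> nat) \<Rightarrow> nat \<Rightarrow> (nat \<Rightarrow> nat) \<Rightarrow> real" where
  "perm_density m \<sigma> n \<pi> =
     real (card {i \<in> position_choices m n. induces m \<sigma> \<pi> i}) / real (card (position_choices m n))"

text \<open>The layers are numbered from \<open>0\<close>, following list indexing: layer \<open>j\<close> consists of the \<open>ls ! j\<close>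
  consecutive positions that come after the first \<open>ls ! 0 + \<dots> + ls ! (j - 1)\<close> ones.\<close>

definition layer :: "nat list \<Rightarrow> nat \<Rightarrow> nat set" where
  "layer ls j = {sum_list (take j ls) <.. sum_list (take (Suc j) ls)}"

text \<open>Layers are nonempty (they are the parts of a partition), so the sizes are positive.\<close>

definition layered :: "nat \<Rightarrow> (nat \<Rightarrow> nat) \<Rightarrow> nat list \<Rightarrow> bool" where
  "layered m \<sigma> ls \<longleftrightarrow>
     \<sigma> permutes {1..m} \<and> sum_list ls = m \<and> (\<forall>l\<in>set ls. l \<ge> 1) \<and>
     (\<forall>j<length ls. strict_antimono_on (layer ls j) \<sigma>) \<and>
     (\<forall>j j' x x'. j < j' \<and> j' < length ls \<and> x \<in> layer ls j \<and> x' \<in> layer ls j' \<longrightarrow> \<sigma> x < \<sigma> x')"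

text \<open>The competitors are all permutations of order \<open>n\<close>, not only the layered ones.\<close>

definition optimal :: "nat \<Rightarrow> (nat \<Rightarrow> nat) \<Rightarrow> nat \<Rightarrow> (nat \<Rightarrow> nat) \<Rightarrow> bool" where
  "optimal m \<sigma> n \<pi> \<longleftrightarrow>
     m \<le> n \<and> \<pi> permutes {1..n} \<and>
     (\<forall>\<pi>'. \<pi>' permutes {1..n} \<longrightarrow> perm_density m \<sigma> n \<pi>' \<le> perm_density m \<sigma> n \<pi>)"

end

theory Submission
  imports Defs "HOL-Library.Infinite_Set"
begin

text \<open>An occurrence of a layered pattern with layers \<open>l\<^sub>1, \<dots>, l\<^sub>k\<close> in a layered permutation with layers
  \<open>a\<^sub>1, \<dots>, a\<^sub>N\<close> takes \<open>l\<^sub>t\<close> points of one host layer for every \<open>t\<close>, so optimal layered permutations maximise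
  \<open>occ = \<Sum> \<Prod> (a\<^sub>j choose l\<^sub>t)\<close> over \<open>j\<^sub>1 < \<dots> < j\<^sub>k\<close>. Comparing the maxima for \<open>n - 1\<close> and \<open>n\<close>
  shows that in a maximiser every point lies in at least a constant times \<open>n\<^sup>m\<^sup>-\<^sup>1\<close> occurrences. A host
  layer of size below \<open>c n\<close> can only achieve this by carrying pattern layers of size 1; for one such \<open>t\<close>,
  the parts of the pattern before and after \<open>t\<close> then have positive density to the left and to the right
  of it. The host positions with this property for a given \<open>t\<close> form a segment. Both
  neighbours of the pattern layer \<open>t\<close> have the size \<open>l = l\<^sub>1\<close>, so the rest of a segment of mass \<open>s\<close>
  can serve as the layer \<open>t\<close>, and merging \<open>l\<close> consecutive host layers of the segment
  gains occurrences through a layer \<open>t - 1\<close> or \<open>t + 1\<close> in the merged one, of order \<open>s\<close>. It loses only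
  occurrences that used two of the merged layers, one of them for a pattern layer of size \<open>l\<close>, of
  order the mass of these layers. Hence any \<open>l\<close> consecutive layers
  of a segment carry a positive fraction of its mass, and segments have bounded length.\<close>

section \<open>Occurrences of a composition in a composition\<close>

text \<open>The first host layer is either left out or hosts the first pattern layer. Host entries
  \<open>0\<close> are allowed, so deleting a point of the host never changes the number of
  entries.\<close>

fun occ :: "nat list \<Rightarrow> nat list \<Rightarrow> nat" where
  "occ [] as = 1"
| "occ (l # ls) [] = 0"
| "occ (l # ls) (a # as) = occ (l # ls) as + (a choose l) * occ ls as"

lemma occ_Cons: "occ ls as \<le> occ ls (a # as)"
  by (cases ls) auto

lemma occ_append_right: "occ ls B \<le> occ ls (A @ B)"
  by (induction A) (auto intro: order_trans[OF _ occ_Cons])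

lemma occ_single: "occ [1] as = sum_list as"
  by (induction as) auto

text \<open>Sorts the occurrences by the number \<open>t\<close> of pattern layers placed in
  \<open>A\<close>; the order of the host layers forces these to be the first
  \<open>t\<close>.\<close>

lemma occ_append:
  "occ ls (A @ B) = (\<Sum>t\<le>length ls. occ (take t ls) A * occ (drop t ls) B)"
proof (induction A arbitrary: ls)
  case Nil
  show ?case
  proof (cases ls)
    case (Cons l ls')
    have "occ (take t ls) [] = (if t = 0 then 1 else 0)" if "t \<le> length ls" for t
      using that Cons by (cases t) auto
    then have "(\<Sum>t\<le>length ls. occ (take t ls) [] * occ (drop t ls) B)
        = (\<Sum>t\<le>length ls. (if t = 0 then 1 else 0) * occ (drop t ls) B)"
      by (intro sum.cong) auto
    also have "\<dots> = (\<Sum>t\<le>length ls. if t = 0 then occ (drop t ls) B else 0)"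
      by (intro sum.cong) auto
    also have "\<dots> = occ ls B" by (simp add: sum.delta)
    finally show ?thesis by simp
  qed simp
next
  case (Cons a A)
  show ?case
  proof (cases ls)
    case (Cons l ls')
    have "occ ls ((a # A) @ B) = occ ls (A @ B) + (a choose l) * occ ls' (A @ B)"
      using Cons by simp
    also have "occ ls (A @ B) = occ ls B + (\<Sum>t\<le>length ls'. occ (l # take t ls') A * occ (drop t ls') B)"
      unfolding Cons.IH[of ls] using Cons by (simp add: sum.atMost_Suc_shift del: sum.atMost_Suc)
    also have "(a choose l) * occ ls' (A @ B) =
       (\<Sum>t\<le>length ls'. (a choose l) * (occ (take t ls') A * occ (drop t ls') B))"
      unfolding Cons.IH[of ls'] by (simp add: sum_distrib_left)
    finally have "occ ls ((a # A) @ B) = occ ls B +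
       (\<Sum>t\<le>length ls'. occ (l # take t ls') (a # A) * occ (drop t ls') B)"
      by (simp add: sum.distrib[symmetric] algebra_simps)
    also have "\<dots> = (\<Sum>t\<le>length ls. occ (take t ls) (a # A) * occ (drop t ls) B)"
      using Cons by (simp add: sum.atMost_Suc_shift del: sum.atMost_Suc)
    finally show ?thesis .
  qed simp
qed

lemma occ_mult_le_append: "occ ls A * occ ls' B \<le> occ (ls @ ls') (A @ B)"
proof -
  have "occ (take (length ls) (ls @ ls')) A * occ (drop (length ls) (ls @ ls')) B
     \<le> occ (ls @ ls') (A @ B)"
    unfolding occ_append by (rule member_le_sum) auto
  then show ?thesis by simp
qed

lemma occ_append_left: "occ ls A \<le> occ ls (A @ B)"
  using occ_mult_le_append[of ls A "[]" B] by simp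

text \<open>An occurrence of the joined pattern is determined by its restrictions to the two
  parts.\<close>

lemma occ_pattern_append_le: "occ (ls @ ls') A \<le> occ ls A * occ ls' A"
proof (induction A arbitrary: ls)
  case Nil
  show ?case by (cases ls; cases ls') auto
next
  case (Cons a A)
  show ?case
  proof (cases ls)
    case (Cons l ls1)
    have "occ (ls @ ls') (a # A) = occ (ls @ ls') A + (a choose l) * occ (ls1 @ ls') A"
      using Cons by simp
    also have "\<dots> \<le> occ ls A * occ ls' A + (a choose l) * (occ ls1 A * occ ls' A)"
      by (intro add_mono mult_left_mono Cons.IH) auto
    also have "\<dots> = occ ls (a # A) * occ ls' A" using Cons by (simp add: algebra_simps)
    also have "\<dots> \<le> occ ls (a # A) * occ ls' (a # A)" by (intro mult_left_mono occ_Cons) auto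
    finally show ?thesis .
  qed simp
qed

lemma binomial_le_power: "(n choose k) \<le> n ^ k"
  by (cases "k \<le> n") (auto simp: binomial_le_pow not_le binomial_eq_0)

lemma power_superadd: "1 \<le> l \<Longrightarrow> (a::nat) ^ l + b ^ l \<le> (a + b) ^ l"
proof (induction l)
  case (Suc l)
  show ?case
  proof (cases "l = 0")
    case False
    then have "a ^ Suc l + b ^ Suc l \<le> (a + b) * (a ^ l + b ^ l)" by (simp add: algebra_simps)
    also have "\<dots> \<le> (a + b) * (a + b) ^ l" using False Suc by (intro mult_left_mono) auto
    finally show ?thesis by simp
  qed simp
qed simp

text \<open>The trivial bound against which positive density is measured later. Leaving out or using
  the first host layer gives two terms that combine by \<open>power_superadd\<close>.\<close>

lemma occ_le_power:
  assumes "\<forall>l\<in>set ls. 1 \<le> l" "sum_list A \<le> n"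
  shows "occ ls A \<le> n ^ sum_list ls"
proof -
  have "occ ls A \<le> sum_list A ^ sum_list ls" using assms(1)
  proof (induction ls A rule: occ.induct)
    case (3 l ls a A)
    have "occ (l # ls) (a # A) \<le> sum_list A ^ (l + sum_list ls) + a ^ l * sum_list A ^ sum_list ls"
      using 3 by (auto intro!: add_mono mult_mono binomial_le_power)
    also have "\<dots> = (sum_list A ^ l + a ^ l) * sum_list A ^ sum_list ls"
      by (simp add: power_add algebra_simps)
    also have "\<dots> \<le> (a + sum_list A) ^ l * (a + sum_list A) ^ sum_list ls"
      using 3 power_superadd[of l "sum_list A" a] by (intro mult_mono power_mono) (auto simp: add.commute)
    finally show ?case by (simp add: power_add)
  qed auto
  also have "\<dots> \<le> n ^ sum_list ls" using assms by (intro power_mono) auto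
  finally show ?thesis .
qed

lemma occ_self: "1 \<le> occ ls ls"
  by (induction ls) (auto simp: add_increasing)

text \<open>An average over the points of the host, since doubling a point of layer \<open>j\<close> enlarges that layer by one.\<close>

lemma weighted_enlarge:
  "(sum_list as + sum_list ls) * occ ls as
     \<le> (\<Sum>j<length as. as ! j * occ ls (as[j := Suc (as ! j)]))"
proof (induction ls as rule: occ.induct)
  case (1 as)
  have "sum_list as = (\<Sum>j<length as. as ! j)" by (simp add: sum_list_sum_nth atLeast0LessThan)
  then show ?case by simp
next
  case (3 l ls a as)
  let ?s = "sum_list as" and ?p = "occ (l # ls) as" and ?q = "occ ls as"
  \<comment> \<open>The case of a single layer. For \<open>0 < l\<close>, Pascal's rule reduces it
    to \<open>l * (a choose l) \<le> a * (a choose (l - 1))\<close>.\<close>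
  have choose: "(a + l) * (a choose l) \<le> a * (Suc a choose l)"
  proof (cases l)
    case (Suc l')
    have "Suc l' * (a choose Suc l') = a * ((a - 1) choose l')" by (rule binomial_absorption)
    also have "\<dots> \<le> a * (a choose l')" by (intro mult_left_mono binomial_right_mono) auto
    finally have "Suc l' * (a choose Suc l') \<le> a * (a choose l')" .
    then show ?thesis using Suc by (simp add: algebra_simps)
  qed simp
  have "(sum_list (a # as) + sum_list (l # ls)) * occ (l # ls) (a # as)
     = (a * ?p + (?s + l + sum_list ls) * ?p) + ((a + l) * (a choose l)) * ?q
        + (a choose l) * ((?s + sum_list ls) * ?q)"
    by (simp add: algebra_simps)
  also have "\<dots> \<le> (a * ?p + (\<Sum>j<length as. as ! j * occ (l # ls) (as[j := Suc (as ! j)])))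
      + (a * (Suc a choose l)) * ?q
      + (a choose l) * (\<Sum>j<length as. as ! j * occ ls (as[j := Suc (as ! j)]))"
    using 3 mult_right_mono[OF choose, of ?q]
    by (intro add_mono mult_left_mono) (auto simp: add.assoc simp del: binomial_Suc_Suc)
  also have "\<dots> = (\<Sum>j<length (a # as). (a # as) ! j * occ (l # ls) ((a # as)[j := Suc ((a # as) ! j)]))"
    by (simp add: sum.lessThan_Suc_shift sum_distrib_left sum.distrib algebra_simps del: sum.lessThan_Suc binomial_Suc_Suc)
  finally show ?case .
qed simp

text \<open>The added sum collects the occurrences that use \<open>x\<close>, sorted by the pattern
  layer \<open>t\<close> hosted there.\<close>

lemma occ_mid:
  "occ ls (A @ x # B) = occ ls (A @ B)
     + (\<Sum>t<length ls. occ (take t ls) A * (x choose (ls ! t)) * occ (drop (Suc t) ls) B)"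
proof -
  have drop: "occ (drop t ls) (x # B) = occ (drop t ls) B + (x choose (ls ! t)) * occ (drop (Suc t) ls) B"
    if "t < length ls" for t
    using that by (simp add: Cons_nth_drop_Suc[symmetric])
  have "occ ls (A @ x # B) = (\<Sum>t<length ls. occ (take t ls) A * occ (drop t ls) (x # B)) + occ ls A"
    unfolding occ_append lessThan_Suc_atMost[symmetric] by simp
  also have "(\<Sum>t<length ls. occ (take t ls) A * occ (drop t ls) (x # B))
     = (\<Sum>t<length ls. occ (take t ls) A * occ (drop t ls) B)
      + (\<Sum>t<length ls. occ (take t ls) A * (x choose (ls ! t)) * occ (drop (Suc t) ls) B)"
    unfolding sum.distrib[symmetric] by (intro sum.cong) (auto simp: drop algebra_simps)
  also have "\<dots> + occ ls A = occ ls (A @ B) + (\<Sum>t<length ls. occ (take t ls) A * (x choose (ls ! t)) * occ (drop (Suc t) ls) B)"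
    unfolding occ_append[of ls A B] lessThan_Suc_atMost[symmetric] by simp
  finally show ?thesis .
qed

text \<open>Splits the occurrences by whether they use neither, exactly one or both of
  \<open>x\<close> and \<open>y\<close>. In the last case the two pattern layers are consecutive,
  because no host layer lies between \<open>x\<close> and \<open>y\<close>; only these occurrences
  are at risk when \<open>x\<close> and \<open>y\<close> are merged.\<close>

lemma occ_pair:
  "occ ls (A @ x # y # B) = occ ls (A @ B)
     + (\<Sum>t<length ls. occ (take t ls) A * ((x choose (ls ! t)) + (y choose (ls ! t))) * occ (drop (Suc t) ls) B)
     + (\<Sum>t<length ls - 1. occ (take t ls) A * (x choose (ls ! t)) * (y choose (ls ! Suc t)) * occ (drop (Suc (Suc t)) ls) B)"
proof -
  let ?X = "\<lambda>t. occ (take t ls) A * (x choose (ls ! t))"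
  have "occ (drop (Suc t) ls) (y # B) = occ (drop (Suc t) ls) B
      + (if t < length ls - 1 then (y choose (ls ! Suc t)) * occ (drop (Suc (Suc t)) ls) B else 0)"
    if "t < length ls" for t
    using that by (auto simp: Cons_nth_drop_Suc[symmetric])
  then have "(\<Sum>t<length ls. ?X t * occ (drop (Suc t) ls) (y # B)) =
     (\<Sum>t<length ls. ?X t * occ (drop (Suc t) ls) B +
        (if t < length ls - 1 then ?X t * (y choose (ls ! Suc t)) * occ (drop (Suc (Suc t)) ls) B else 0))"
    by (intro sum.cong) (auto simp: algebra_simps)
  also have "\<dots> = (\<Sum>t<length ls. ?X t * occ (drop (Suc t) ls) B) +
     (\<Sum>t\<in>{t\<in>{..<length ls}. t < length ls - 1}. ?X t * (y choose (ls ! Suc t)) * occ (drop (Suc (Suc t)) ls) B)"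
    unfolding sum.distrib by (subst sum.inter_filter) simp_all
  also have "{t\<in>{..<length ls}. t < length ls - 1} = {..<length ls - 1}" by auto
  finally have *: "(\<Sum>t<length ls. ?X t * occ (drop (Suc t) ls) (y # B)) = 
     (\<Sum>t<length ls. ?X t * occ (drop (Suc t) ls) B) +
     (\<Sum>t<length ls - 1. ?X t * (y choose (ls ! Suc t)) * occ (drop (Suc (Suc t)) ls) B)" .
  show ?thesis unfolding occ_mid[of ls A x] occ_mid[of ls A y] *
    by (simp add: sum.distrib algebra_simps)
qed

section \<open>Pattern occurrences in layered permutations\<close>

definition strict_mono_maps :: "nat set \<Rightarrow> nat set \<Rightarrow> (nat \<Rightarrow> nat) set" where
  "strict_mono_maps A B = {i \<in> A \<rightarrow>\<^sub>E B. strict_mono_on A i}"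

lemma finite_strict_mono_maps: "finite A \<Longrightarrow> finite B \<Longrightarrow> finite (strict_mono_maps A B)"
  unfolding strict_mono_maps_def by (auto intro: finite_subset[OF _ finite_PiE[of A "\<lambda>_. B"]])

text \<open>By induction, both maps must send \<open>x\<close> to the least image value not taken by
  smaller arguments.\<close>

lemma strict_mono_maps_eqI:
  assumes i: "i \<in> strict_mono_maps A B" and j: "j \<in> strict_mono_maps A B" and img: "i ` A = j ` A"
  shows "i = j"
proof -
  have "x \<in> A \<Longrightarrow> i x = j x" for x
  proof (induction x rule: less_induct)
    case (less x)
    have le: "f x \<le> g x" if f: "f \<in> strict_mono_maps A B" and g: "g \<in> strict_mono_maps A B" 
      and img: "f ` A = g ` A" and eq: "\<And>y. y < x \<Longrightarrow> y \<in> A \<Longrightarrow> f y = g y" for f g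
    proof -
      obtain z where z: "z \<in> A" "g x = f z" using img less.prems by (metis image_iff)
      have "\<not> z < x"
        using eq[of z] z g less.prems by (auto simp: strict_mono_maps_def strict_mono_on_def) force
      then have "x = z \<or> x < z" by auto
      then show ?thesis
        using f z less.prems by (auto simp: strict_mono_maps_def strict_mono_on_def less_imp_le)
    qed
    show ?case using le[OF i j img] le[OF j i img[symmetric]] less.IH by force
  qed
  then show ?thesis using i j by (auto simp: strict_mono_maps_def intro: PiE_ext)
qed

lemma card_strict_mono_maps:
  assumes "finite A" "finite B"
  shows "card (strict_mono_maps A B) = card B choose card A"
proof -
  have "inj_on (\<lambda>i. i ` A) (strict_mono_maps A B)"
    by (rule inj_onI) (rule strict_mono_maps_eqI)
  moreover have "(\<lambda>i. i ` A) ` strict_mono_maps A B = {S. S \<subseteq> B \<and> card S = card A}"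
  proof (intro equalityI subsetI)
    fix S assume "S \<in> (\<lambda>i. i ` A) ` strict_mono_maps A B"
    then obtain i where i: "i \<in> A \<rightarrow>\<^sub>E B" "strict_mono_on A i" "S = i ` A"
      by (auto simp: strict_mono_maps_def)
    then show "S \<in> {S. S \<subseteq> B \<and> card S = card A}"
      using card_image[OF strict_mono_on_imp_inj_on[OF i(2)]] by auto
  next
    fix S assume S: "S \<in> {S. S \<subseteq> B \<and> card S = card A}"
    then have "finite S" using assms finite_subset by blast
    then obtain f where f: "bij_betw f {..<card A} S" "strict_mono_on {..<card A} f"
      using S ex_bij_betw_strict_mono_card[of S] by auto
    obtain g where g: "bij_betw g {..<card A} A" "strict_mono_on {..<card A} g"
      using ex_bij_betw_strict_mono_card[OF assms(1)] by auto
    \<comment> \<open>The increasing bijection from \<open>A\<close> to \<open>S\<close> goes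
      through the increasing enumerations of both sets.\<close>
    define h where "h = f \<circ> the_inv_into {..<card A} g"
    have "strict_mono_on A h"
    proof (rule strict_mono_onI)
      fix x y assume xy: "x \<in> A" "y \<in> A" "x < y"
      then obtain j k where jk: "x = g j" "y = g k" "j < card A" "k < card A"
        using g(1) unfolding bij_betw_def by (metis imageE lessThan_iff)
      have "\<not> k \<le> j"
        using strict_mono_on_leD[OF g(2), of k j] jk xy by auto
      moreover have "h x = f j" "h y = f k"
        using jk bij_betw_imp_inj_on[OF g(1)] by (auto simp: h_def the_inv_into_f_f)
      ultimately show "h x < h y" using f(2) jk by (auto simp: strict_mono_on_def)
    qed
    moreover have "bij_betw h A S"
      unfolding h_def using bij_betw_trans[OF bij_betw_the_inv_into[OF g(1)] f(1)] .
    ultimately have h: "bij_betw h A S" "strict_mono_on A h" by auto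
    have "restrict h A \<in> strict_mono_maps A B"
      using h S by (auto simp: strict_mono_maps_def bij_betw_def strict_mono_on_def)
    moreover have "restrict h A ` A = S" using h by (auto simp: bij_betw_def)
    ultimately show "S \<in> (\<lambda>i. i ` A) ` strict_mono_maps A B" by blast
  qed
  ultimately have "card (strict_mono_maps A B) = card {S. S \<subseteq> B \<and> card S = card A}"
    by (metis card_image)
  then show ?thesis using n_subsets[OF assms(2)] by simp
qed

section \<open>Embeddings and their count, layer by layer\<close>

definition embeddings :: "(nat \<Rightarrow> nat) \<Rightarrow> nat set \<Rightarrow> (nat \<Rightarrow> nat) \<Rightarrow> nat set \<Rightarrow> (nat \<Rightarrow> nat) set" where
  "embeddings \<sigma> A \<pi> B =
     {i \<in> strict_mono_maps A B. \<forall>x\<in>A. \<forall>y\<in>A. \<pi> (i x) < \<pi> (i y) \<longleftrightarrow> \<sigma> x < \<sigma> y}"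

lemma finite_embeddings: "finite A \<Longrightarrow> finite B \<Longrightarrow> finite (embeddings \<sigma> A \<pi> B)"
  unfolding embeddings_def using finite_strict_mono_maps by simp

text \<open>Blocks are arbitrary finite position sets, possibly empty, instead of intervals counted
  from \<open>1\<close>. Inductions can thus discard the first layer without renumbering the
  rest.\<close>

fun layer_blocks :: "(nat \<Rightarrow> nat) \<Rightarrow> nat set list \<Rightarrow> bool" where
  "layer_blocks \<sigma> [] = True"
| "layer_blocks \<sigma> (A # As) \<longleftrightarrow> finite A \<and> strict_antimono_on A \<sigma> \<and>
     (\<forall>x\<in>A. \<forall>y\<in>\<Union>(set As). x < y \<and> \<sigma> x < \<sigma> y) \<and> layer_blocks \<sigma> As"

lemma finite_layer_blocks: "layer_blocks \<sigma> As \<Longrightarrow> finite (\<Union>(set As))"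
  by (induction As) auto

text \<open>An embedding that meets the first layer of the host maps exactly the first layer of the
  pattern into it.\<close>

lemma card_embeddings_first_layer:
  assumes A: "layer_blocks \<sigma> (A # As)" "A \<noteq> {}" and B: "layer_blocks \<pi> (B # Bs)"
  defines "A' \<equiv> \<Union>(set As)" and "B' \<equiv> \<Union>(set Bs)"
  shows "card {i \<in> embeddings \<sigma> (A \<union> A') \<pi> (B \<union> B'). i ` (A \<union> A') \<inter> B \<noteq> {}}
       = (card B choose card A) * card (embeddings \<sigma> A' \<pi> B')"
proof -
  have fin: "finite A" "finite A'" "finite B" "finite B'"
    using A B finite_layer_blocks[OF A(1)] finite_layer_blocks[OF B] by (auto simp: A'_def B'_def)
  have Ax: "\<And>x y. x \<in> A \<Longrightarrow> y \<in> A' \<Longrightarrow> x < y \<and> \<sigma> x < \<sigma> y"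
    and Aa: "\<And>x y. x \<in> A \<Longrightarrow> y \<in> A \<Longrightarrow> x < y \<Longrightarrow> \<sigma> y < \<sigma> x"
    and Bx: "\<And>x y. x \<in> B \<Longrightarrow> y \<in> B' \<Longrightarrow> x < y \<and> \<pi> x < \<pi> y"
    and Ba: "\<And>x y. x \<in> B \<Longrightarrow> y \<in> B \<Longrightarrow> x < y \<Longrightarrow> \<pi> y < \<pi> x"
    using A B by (auto simp: A'_def B'_def monotone_on_def)
  have disj: "A \<inter> A' = {}" "B \<inter> B' = {}" using Ax Bx by blast+
  let ?E = "{i \<in> embeddings \<sigma> (A \<union> A') \<pi> (B \<union> B'). i ` (A \<union> A') \<inter> B \<noteq> {}}"
  let ?P = "strict_mono_maps A B \<times> embeddings \<sigma> A' \<pi> B'"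
  let ?split = "\<lambda>i. (restrict i A, restrict i A')"
  let ?glue = "\<lambda>(f, g). \<lambda>x. if x \<in> A then f x else (g x :: nat)"
  have E: "(\<forall>x\<in>A. i x \<in> B) \<and> (\<forall>x\<in>A'. i x \<in> B')" if i: "i \<in> ?E" for i
  proof -
    have im: "\<And>x. x \<in> A \<union> A' \<Longrightarrow> i x \<in> B \<union> B'"
      and mono: "\<And>x y. x \<in> A \<union> A' \<Longrightarrow> y \<in> A \<union> A' \<Longrightarrow> x < y \<Longrightarrow> i x < i y"
      and pat: "\<And>x y. x \<in> A \<union> A' \<Longrightarrow> y \<in> A \<union> A' \<Longrightarrow> \<pi> (i x) < \<pi> (i y) \<longleftrightarrow> \<sigma> x < \<sigma> y"
      using i by (auto simp: embeddings_def strict_mono_maps_def strict_mono_on_def PiE_def Pi_def)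
    obtain z where z: "z \<in> A \<union> A'" "i z \<in> B" using i by auto
    \<comment> \<open>The least point of \<open>A\<close> is at most \<open>z\<close>, so it lands
      in \<open>B\<close> as well. The other points of \<open>A\<close> have smaller values and
      cannot go to \<open>B'\<close>, which lies above \<open>B\<close>. The points of
      \<open>A'\<close> lie to the right of \<open>x0\<close> and above it, which is impossible
      inside the decreasing block \<open>B\<close>.\<close>
    define x0 where "x0 = Min A"
    have x0: "x0 \<in> A" "\<And>y. y \<in> A \<Longrightarrow> x0 \<le> y"
      using fin A(2) by (auto simp: x0_def)
    have "x0 = z \<or> x0 < z" using z x0 Ax by force
    then have "i x0 \<le> i z" using mono[of x0 z] x0 z by auto
    then have ix0: "i x0 \<in> B" using im[of x0] x0 z Bx[of "i z" "i x0"] by auto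
    have 1: "i y \<in> B" if y: "y \<in> A" for y
    proof (rule ccontr)
      assume n: "i y \<notin> B"
      then have "y \<noteq> x0" using ix0 by auto
      then have "x0 < y" using x0(2)[OF y] by simp
      then have "\<sigma> y < \<sigma> x0" using Aa x0 y by blast
      then have "\<pi> (i y) < \<pi> (i x0)" using pat x0 y by blast
      moreover have "i y \<in> B'" using im[of y] y n by auto
      ultimately show False using Bx[OF ix0] by force
    qed
    have 2: "i y \<in> B'" if y: "y \<in> A'" for y
    proof (rule ccontr)
      assume "i y \<notin> B'"
      then have "i y \<in> B" using im[of y] y by auto
      moreover have "x0 < y" "\<sigma> x0 < \<sigma> y" using Ax x0 y by auto
      ultimately show False using mono[of x0 y] pat[of x0 y] Ba[of "i x0" "i y"] ix0 x0 y by force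
    qed
    show ?thesis using 1 2 by blast
  qed
  have "bij_betw ?split ?E ?P"
  proof (rule bij_betw_byWitness[where f' = ?glue])
    show "\<forall>i\<in>?E. ?glue (?split i) = i"
      by (auto simp: embeddings_def strict_mono_maps_def PiE_def extensional_def fun_eq_iff)
    show "\<forall>p\<in>?P. ?split (?glue p) = p"
      using disj by (auto simp: embeddings_def strict_mono_maps_def PiE_def extensional_def fun_eq_iff)
    show "?split ` ?E \<subseteq> ?P"
    proof (rule image_subsetI)
      fix i assume i: "i \<in> ?E"
      then show "?split i \<in> ?P" using E[OF i]
        by (auto simp: embeddings_def strict_mono_maps_def strict_mono_on_def)
    qed
    show "?glue ` ?P \<subseteq> ?E"
    proof (rule image_subsetI)
      fix p assume p: "p \<in> ?P"
      obtain f g where fg: "p = (f, g)" by force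
      define h where "h = (\<lambda>x. if x \<in> A then f x else g x)"
      have hA: "\<And>x. x \<in> A \<Longrightarrow> h x = f x \<and> f x \<in> B" and hA': "\<And>x. x \<in> A' \<Longrightarrow> h x = g x \<and> g x \<in> B'"
        and ext: "\<And>x. x \<notin> A \<union> A' \<Longrightarrow> h x = undefined"
        using p fg disj by (auto simp: h_def embeddings_def strict_mono_maps_def)
      have f: "\<And>x y. x \<in> A \<Longrightarrow> y \<in> A \<Longrightarrow> x < y \<Longrightarrow> f x < f y"
        and g: "\<And>x y. x \<in> A' \<Longrightarrow> y \<in> A' \<Longrightarrow> x < y \<Longrightarrow> g x < g y"
        and gp: "\<And>x y. x \<in> A' \<Longrightarrow> y \<in> A' \<Longrightarrow> \<pi> (g x) < \<pi> (g y) \<longleftrightarrow> \<sigma> x < \<sigma> y"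
        using p fg by (auto simp: embeddings_def strict_mono_maps_def strict_mono_on_def)
      have mono: "h x < h y" if "x \<in> A \<union> A'" "y \<in> A \<union> A'" "x < y" for x y
        using that hA[of x] hA[of y] hA'[of x] hA'[of y] f[of x y] g[of x y] Ax[of y x]
          Bx[of "f x" "g y"] by auto
      have fp: "\<pi> (f x) < \<pi> (f y) \<longleftrightarrow> \<sigma> x < \<sigma> y" if "x \<in> A" "y \<in> A" for x y
      proof (cases x y rule: linorder_cases)
        case less
        then show ?thesis using Aa[OF that less] Ba[of "f x" "f y"] f[OF that less] hA that by force
      next
        case greater
        then show ?thesis using Aa[OF that(2,1) greater] Ba[of "f y" "f x"] f[OF that(2,1) greater] hA that
          by force
      qed simp
      have pat: "\<pi> (h x) < \<pi> (h y) \<longleftrightarrow> \<sigma> x < \<sigma> y" if xy: "x \<in> A \<union> A'" "y \<in> A \<union> A'" for x y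
      proof -
        consider "x \<in> A" "y \<in> A" | "x \<in> A" "y \<in> A'" | "x \<in> A'" "y \<in> A" | "x \<in> A'" "y \<in> A'"
          using xy by blast
        then show ?thesis
        proof cases
          case 2
          then show ?thesis using hA[of x] hA'[of y] Ax[of x y] Bx[of "f x" "g y"] by auto
        next
          case 3
          then show ?thesis using hA[of y] hA'[of x] Ax[of y x] Bx[of "f y" "g x"] by auto
        qed (use hA hA' fp gp in auto)
      qed
      have "h \<in> embeddings \<sigma> (A \<union> A') \<pi> (B \<union> B')"
        using mono pat hA hA' ext
        by (auto simp: embeddings_def strict_mono_maps_def strict_mono_on_def PiE_def extensional_def)
      moreover have "h ` (A \<union> A') \<inter> B \<noteq> {}" using hA A(2) by fastforce
      ultimately show "?glue p \<in> ?E" using fg h_def by simp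
    qed
  qed
  then have "card ?E = card ?P" by (rule bij_betw_same_card)
  then show ?thesis using fin by (simp add: card_cartesian_product card_strict_mono_maps)
qed

lemma embeddings_avoid:
  assumes "B \<inter> B' = {}"
  shows "{i \<in> embeddings \<sigma> A \<pi> (B \<union> B'). i ` A \<inter> B = {}} = embeddings \<sigma> A \<pi> B'"
  using assms by (auto simp: embeddings_def strict_mono_maps_def PiE_def Pi_def)

text \<open>The embeddings that avoid the first host block and those that meet it give the two
  summands in the recursion of \<open>occ\<close>.\<close>

lemma card_embeddings:
  assumes "layer_blocks \<sigma> As" "\<forall>A\<in>set As. A \<noteq> {}" "layer_blocks \<pi> Bs"
  shows "card (embeddings \<sigma> (\<Union>(set As)) \<pi> (\<Union>(set Bs))) = occ (map card As) (map card Bs)"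
  using assms
proof (induction Bs arbitrary: As)
  case Nil
  show ?case
  proof (cases As)
    case Nil
    then show ?thesis by (simp add: embeddings_def strict_mono_maps_def)
  next
    case (Cons A As')
    then have "embeddings \<sigma> (\<Union>(set As)) \<pi> {} = {}"
      using Nil.prems by (auto simp: embeddings_def strict_mono_maps_def)
    then show ?thesis using Cons by simp
  qed
next
  case (Cons B Bs)
  show ?case
  proof (cases As)
    case Nil
    have "embeddings \<sigma> {} \<pi> (\<Union>(set (B # Bs))) = {\<lambda>x. undefined}" 
      by (auto simp: embeddings_def strict_mono_maps_def)
    then show ?thesis using Nil by simp
  next
    case (Cons A As')
    let ?A = "\<Union>(set As)" and ?B = "\<Union>(set Bs)"
    let ?E = "embeddings \<sigma> ?A \<pi> (B \<union> ?B)"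
    have disj: "B \<inter> ?B = {}" using Cons.prems(3) by force
    have fin: "finite ?E"
      using finite_layer_blocks[OF Cons.prems(1)] finite_layer_blocks[OF Cons.prems(3)]
      by (intro finite_embeddings) auto
    have 1: "{i \<in> ?E. i ` ?A \<inter> B = {}} = embeddings \<sigma> ?A \<pi> ?B"
      using embeddings_avoid[OF disj] .
    have 2: "card {i \<in> ?E. i ` ?A \<inter> B \<noteq> {}} =
       (card B choose card A) * card (embeddings \<sigma> (\<Union>(set As')) \<pi> ?B)"
      using card_embeddings_first_layer[of \<sigma> A As' \<pi> B Bs] Cons Cons.prems by auto
    have "?E = {i \<in> ?E. i ` ?A \<inter> B = {}} \<union> {i \<in> ?E. i ` ?A \<inter> B \<noteq> {}}" by blast
    then have "card ?E = card {i \<in> ?E. i ` ?A \<inter> B = {}} + card {i \<in> ?E. i ` ?A \<inter> B \<noteq> {}}"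
      using fin by (subst card_Un_disjoint[symmetric]) auto
    also have "\<dots> = occ (map card As) (map card Bs) + (card B choose card A) * occ (map card As') (map card Bs)"
      unfolding 1 2 using Cons.IH[of As] Cons.IH[of As'] Cons Cons.prems by auto
    finally show ?thesis using Cons by simp
  qed
qed

lemma layer_blocks_map:
  assumes "\<And>j. j < n \<Longrightarrow> finite (f j)" "\<And>j. j < n \<Longrightarrow> strict_antimono_on (f j) \<sigma>"
    "\<And>j j' x y. j < j' \<Longrightarrow> j' < n \<Longrightarrow> x \<in> f j \<Longrightarrow> y \<in> f j' \<Longrightarrow> x < y \<and> \<sigma> x < \<sigma> y"
  shows "layer_blocks \<sigma> (map f [k..<n])"
proof (induction "n - k" arbitrary: k)
  case (Suc d)
  then have "k < n" by simp
  have "x < y \<and> \<sigma> x < \<sigma> y" if "x \<in> f k" "y \<in> \<Union>(set (map f [Suc k..<n]))" for x y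
    using that assms(3)[of k _ x y] by (auto simp: Suc_le_eq)
  moreover have "layer_blocks \<sigma> (map f [Suc k..<n])" using Suc by simp
  ultimately show ?case using assms(1,2) \<open>k < n\<close> by (simp add: upt_rec[of k n])
qed simp

section \<open>Block form of a layered permutation\<close>

lemma sum_list_take_mono: "i \<le> j \<Longrightarrow> sum_list (take i as) \<le> sum_list (take j (as :: nat list))"
proof -
  assume "i \<le> j"
  then obtain d where "j = i + d" using le_Suc_ex by blast
  then show ?thesis by (simp add: take_add)
qed

lemma card_layer: "j < length as \<Longrightarrow> card (layer as j) = as ! j"
  by (simp add: layer_def take_Suc_conv_app_nth)

lemma Union_layer: "\<Union>(layer as ` {..<k}) = {1..sum_list (take k as)}"
proof (induction k)
  case (Suc k)
  show ?case unfolding lessThan_Suc image_insert Union_insert Suc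
    using sum_list_take_mono[of k "Suc k" as] by (auto simp: layer_def)
qed simp

lemma layer_blocks_layered:
  assumes "layered n \<pi> as"
  defines "Bs \<equiv> map (layer as) [0..<length as]"
  shows "layer_blocks \<pi> Bs" "map card Bs = as" "\<Union>(set Bs) = {1..n}"
proof -
  show "layer_blocks \<pi> Bs" unfolding Bs_def
  proof (rule layer_blocks_map)
    fix j j' x y assume *: "j < j'" "j' < length as" "x \<in> layer as j" "y \<in> layer as j'"
    then have "x < y"
      using sum_list_take_mono[of "Suc j" j' as] by (auto simp: layer_def)
    then show "x < y \<and> \<pi> x < \<pi> y" using * assms(1) unfolding layered_def by blast
  qed (use assms(1) in \<open>auto simp: layered_def layer_def[of as]\<close>)
  show "map card Bs = as" unfolding Bs_def by (auto simp: card_layer intro!: nth_equalityI)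
  show "\<Union>(set Bs) = {1..n}" using Union_layer[of as "length as"] assms(1)
    by (auto simp: Bs_def layered_def atLeast0LessThan)
qed

section \<open>Layered permutations with prescribed layer sizes\<close>

fun reverse_layers :: "nat \<Rightarrow> nat list \<Rightarrow> nat \<Rightarrow> nat" where
  "reverse_layers s [] x = x"
| "reverse_layers s (a # as) x =
     (if x \<in> {s <.. s + a} then 2 * s + a + 1 - x else reverse_layers (s + a) as x)"

lemma reverse_layers_outside: "x \<notin> {s <.. s + sum_list as} \<Longrightarrow> reverse_layers s as x = x"
  by (induction s as x rule: reverse_layers.induct) auto

lemma reverse_layers_in: "x \<in> {s <.. s + sum_list as} \<Longrightarrow> reverse_layers s as x \<in> {s <.. s + sum_list as}"
  by (induction s as x rule: reverse_layers.induct) auto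

lemma reverse_layers_involution: "reverse_layers s as (reverse_layers s as x) = x"
proof (induction s as x rule: reverse_layers.induct)
  case (2 s a as x)
  show ?case
  proof (cases "x \<in> {s <.. s + a}")
    case False
    have eq: "reverse_layers s (a # as) z = reverse_layers (s + a) as z" if "z \<notin> {s <.. s + a}" for z
      using that by (simp only: reverse_layers.simps if_False)
    have "reverse_layers (s + a) as x \<notin> {s <.. s + a}"
      using False reverse_layers_in[of x "s + a" as] reverse_layers_outside[of x "s + a" as] by force
    then show ?thesis unfolding eq[OF False] using eq 2 False by metis
  qed auto
qed simp

lemma reverse_layers_permutes: "reverse_layers s as permutes {s <.. s + sum_list as}"
  unfolding permutes_def
  by (intro conjI allI impI reverse_layers_outside ex1I[of _ "reverse_layers s as y" for y])
    (auto simp: reverse_layers_involution)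

text \<open>Reflecting an interval turns it into a decreasing layer. A size \<open>0\<close> becomes
  an empty block, which \<open>layered\<close> excludes; the formulation with blocks keeps every
  list available as a competitor.\<close>

lemma ex_layer_blocks:
  "\<exists>Bs. layer_blocks (reverse_layers s as) Bs \<and> map card Bs = as \<and> \<Union>(set Bs) = {s <.. s + sum_list as}"
proof (induction as arbitrary: s)
  case Nil
  show ?case by simp
next
  case (Cons a as)
  obtain Bs where Bs: "layer_blocks (reverse_layers (s + a) as) Bs" "map card Bs = as"
    "\<Union>(set Bs) = {s + a <.. s + a + sum_list as}" using Cons[of "s + a"] by blast
  have cong: "layer_blocks \<sigma> Cs \<Longrightarrow> (\<And>x. x \<in> \<Union>(set Cs) \<Longrightarrow> \<sigma> x = \<sigma>' x) \<Longrightarrow> layer_blocks \<sigma>' Cs" for \<sigma> \<sigma>' :: "nat \<Rightarrow> nat" and Cs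
    by (induction Cs) (auto simp: monotone_on_def)
  define \<rho> where "\<rho> = reverse_layers s (a # as)"
  have "layer_blocks \<rho> Bs" unfolding \<rho>_def
    by (rule cong[OF Bs(1)]) (use Bs(3) in auto)
  moreover have "\<rho> x < \<rho> y"
    if "x \<in> {s <.. s + a}" "y \<in> {s + a <.. s + a + sum_list as}" for x y
    unfolding \<rho>_def using that reverse_layers_in[OF that(2)] by auto
  moreover have "strict_antimono_on {s <.. s + a} \<rho>"
    by (auto simp: monotone_on_def \<rho>_def)
  ultimately have 1: "layer_blocks \<rho> ({s <.. s + a} # Bs)"
    using Bs(3) by auto
  have 2: "\<Union>(set ({s <.. s + a} # Bs)) = {s <.. s + sum_list (a # as)}"
    using Bs(3) by auto
  have 3: "map card ({s <.. s + a} # Bs) = a # as" using Bs(2) by simp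
  show ?case unfolding \<rho>_def[symmetric]
    by (rule exI[of _ "{s <.. s + a} # Bs"], rule conjI[OF 1 conjI[OF 3 2]])
qed

text \<open>The host is given by blocks only, so this covers both layered hosts and competitors with
  empty blocks.\<close>

lemma perm_density_blocks:
  assumes "layered m \<sigma> ls" "layer_blocks \<pi> Bs" "\<Union>(set Bs) = {1..n}" 
  shows "perm_density m \<sigma> n \<pi> = occ ls (map card Bs) / (n choose m)"
proof -
  let ?As = "map (layer ls) [0..<length ls]"
  note A = layer_blocks_layered[OF assms(1)]
  have ne: "\<forall>A\<in>set ?As. A \<noteq> {}"
  proof -
    have "layer ls j \<noteq> {}" if "j < length ls" for j
      using card_layer[OF that] that assms(1) by (auto simp: layered_def dest!: nth_mem)
    then show ?thesis by auto
  qed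
  have pc: "position_choices m n = strict_mono_maps {1..m} {1..n}"
    by (simp add: position_choices_def strict_mono_maps_def)
  have "{i \<in> position_choices m n. induces m \<sigma> \<pi> i} = embeddings \<sigma> {1..m} \<pi> {1..n}"
    by (auto simp: pc embeddings_def induces_def)
  then have "card {i \<in> position_choices m n. induces m \<sigma> \<pi> i} = occ ls (map card Bs)"
    using card_embeddings[OF A(1) ne assms(2)] A assms by simp
  then show ?thesis by (simp add: perm_density_def pc card_strict_mono_maps)
qed

text \<open>The permutation \<open>reverse_layers 0 bs\<close> is a competitor, and both densities
  have the same positive denominator.\<close>

lemma optimal_layered_occ:
  assumes "layered m \<sigma> ls" "optimal m \<sigma> n \<pi>" "layered n \<pi> as" "sum_list bs = n"
  shows "occ ls bs \<le> occ ls as"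
proof -
  obtain Bs where Bs: "layer_blocks (reverse_layers 0 bs) Bs" "map card Bs = bs" "\<Union>(set Bs) = {0 <.. n}"
    using ex_layer_blocks[of 0 bs] assms(4) by auto
  have n: "{0 <.. n} = {1..n}" by auto
  have "reverse_layers 0 bs permutes {1..n}"
    using reverse_layers_permutes[of 0 bs] assms(4) n by simp
  then have "perm_density m \<sigma> n (reverse_layers 0 bs) \<le> perm_density m \<sigma> n \<pi>"
    using assms(2) by (simp add: optimal_def)
  moreover have "0 < n choose m" using assms(2) by (simp add: optimal_def)
  moreover note layer_blocks_layered[OF assms(3)]
  ultimately show ?thesis
    using perm_density_blocks[OF assms(1) Bs(1)] Bs n perm_density_blocks[OF assms(1)]
    by (simp add: divide_le_cancel)
qed

section \<open>Merging layers\<close>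

lemma binomial_superadd: "1 \<le> l \<Longrightarrow> (x choose l) + (y choose l) \<le> (x + y choose l)"
proof (induction x)
  case (Suc x)
  then obtain l' where l: "l = Suc l'" by (cases l) auto
  have "(x choose l') \<le> (x + y choose l')" by (intro binomial_right_mono) simp
  then show ?case using Suc l by simp
qed simp

text \<open>Among the \<open>l\<close>-subsets of a disjoint union of sizes \<open>x\<close> and
  \<open>y\<close>, the left side counts those within one part and those with exactly one element in
  the first part. As \<open>2 \<le> l\<close>, the latter meet both parts, so nothing is counted
  twice.\<close>

lemma binomial_superadd_linear:
  "2 \<le> l \<Longrightarrow> (x choose l) + (y choose l) + x * (y choose (l - 1)) \<le> (x + y choose l)"
proof (induction x)
  case (Suc x)
  then obtain l' where l: "l = Suc l'" by (cases l) auto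
  show ?case using Suc l binomial_superadd[of l' x y] by simp
qed simp

text \<open>If one part has at least \<open>l - 1\<close> elements, these and one element of the
  other part form an \<open>l\<close>-subset meeting both. Otherwise the left side is
  \<open>0\<close>.\<close>

lemma binomial_superadd_strict:
  assumes "2 \<le> l" "1 \<le> x" "1 \<le> y" "l \<le> x + y"
  shows "(x choose l) + (y choose l) < (x + y choose l)"
proof -
  consider "l - 1 \<le> y" | "l - 1 \<le> x" | "x < l - 1" "y < l - 1" by linarith
  then show ?thesis
  proof cases
    case 1
    then have "0 < x * (y choose (l - 1))" using assms by simp
    then show ?thesis using binomial_superadd_linear[of l x y] assms by linarith
  next
    case 2
    then have "0 < y * (x choose (l - 1))" using assms by simp
    then show ?thesis using binomial_superadd_linear[of l y x] assms unfolding add.commute[of y x] by linarith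
  next
    case 3
    moreover have "0 < (x + y choose l)" using assms by simp
    ultimately show ?thesis by (simp add: binomial_eq_0)
  qed
qed

lemma binomial_le_times: 
  assumes "1 \<le> l" shows "(x choose l) \<le> x * (x choose (l - 1))"
proof -
  have "(x choose l) \<le> l * (x choose l)" using assms by simp
  also have "\<dots> = x * ((x - 1) choose (l - 1))" using assms by (intro times_binomial_minus1_eq) auto
  also have "\<dots> \<le> x * (x choose (l - 1))" by (intro mult_left_mono binomial_right_mono) auto
  finally show ?thesis .
qed

lemma sum_list_split_nth:
  "t < length ls \<Longrightarrow> sum_list (take t ls) + ls ! t + sum_list (drop (Suc t) ls) = sum_list (ls :: nat list)"
  by (metis add.assoc id_take_nth_drop sum_list.Cons sum_list_append)

lemma binomial_le_linear_pow:
  assumes "1 \<le> l" "y \<le> n" shows "(y choose l) * n \<le> y * n ^ l"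
proof -
  obtain l' where l: "l = Suc l'" using assms by (cases l) auto
  have "(y choose l) \<le> y * y ^ l'" using binomial_le_power[of y l] l by simp
  also have "\<dots> \<le> y * n ^ l'" using assms by (intro mult_left_mono power_mono) auto
  finally show ?thesis using l by (simp add: algebra_simps)
qed

text \<open>Merging gains \<open>G\<close> choices in every occurrence that places the pattern layer
  \<open>p\<close> in the merged layer. It may lose occurrences in which \<open>x\<close> and
  \<open>y\<close> host consecutive pattern layers. One of these layers has size \<open>l\<close>,
  so by \<open>binomial_superadd_linear\<close> the loss is also a multiple of \<open>G\<close>,
  with a factor of order \<open>d\<close>. Assumption \<open>gain\<close> says that the first factor
  is larger; powers of \<open>n\<close> are multiplied out to stay in the natural numbers.\<close>

lemma merge_pair:
  assumes pos: "\<forall>l\<in>set ls. 1 \<le> l" and l: "2 \<le> l"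
    and adj: "\<And>i. Suc i < length ls \<Longrightarrow> ls ! i = l \<or> ls ! Suc i = l"
    and size: "sum_list A + x + y + sum_list B \<le> n"
    and p: "p < length ls" "ls ! p = l"
    and d: "x \<le> d" "y \<le> d" "1 \<le> x" "1 \<le> y"
    and gain: "length ls * d * n ^ sum_list ls
       < occ (take p ls) A * occ (drop (Suc p) ls) B * n ^ (l + 1)"
  shows "occ ls (A @ x # y # B) \<le> occ ls (A @ (x + y) # B)" (is ?le)
    and "l \<le> x + y \<Longrightarrow> occ ls (A @ x # y # B) < occ ls (A @ (x + y) # B)"
proof -
  let ?m = "sum_list ls" and ?k = "length ls"
  let ?L = "\<lambda>t. occ (take t ls) A" and ?R = "\<lambda>t. occ (drop t ls) B"
  define G where "G = (x + y choose l) - (x choose l) - (y choose l)"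
  have G: "(x + y choose l) = (x choose l) + (y choose l) + G"
    using binomial_superadd[of l x y] l by (simp add: G_def)
  have Gx: "x * (y choose (l - 1)) \<le> G" using G binomial_superadd_linear[of l x y] l by simp
  have Gy: "y * (x choose (l - 1)) \<le> G"
    using G binomial_superadd_linear[of l y x] l by (simp add: add.commute)
  let ?T = "\<lambda>t. ?L t * (x choose (ls ! t)) * (y choose (ls ! Suc t)) * ?R (Suc (Suc t))"
  have T: "n ^ (l + 1) * ?T t \<le> d * G * n ^ ?m" if t: "t < ?k - 1" for t
  proof -
    have pos': "\<forall>l\<in>set (take t ls). 1 \<le> l" "\<forall>l\<in>set (drop (Suc (Suc t)) ls). 1 \<le> l"
      "1 \<le> ls ! t" "1 \<le> ls ! Suc t"
      using pos t by (auto dest: in_set_takeD in_set_dropD)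
    have LR: "?L t \<le> n ^ sum_list (take t ls)" "?R (Suc (Suc t)) \<le> n ^ sum_list (drop (Suc (Suc t)) ls)"
      using pos' size by (auto intro!: occ_le_power)
    have m: "?m = sum_list (take t ls) + ls ! t + (ls ! Suc t + sum_list (drop (Suc (Suc t)) ls))"
      using t sum_list_split_nth[of t ls] by (simp add: Cons_nth_drop_Suc[of "Suc t", symmetric])
    \<comment> \<open>The pattern layer of size \<open>l\<close>, together with one factor
      \<open>x\<close> or \<open>y\<close> from the other layer, yields \<open>d * G\<close>; what
      remains is bounded by powers of \<open>n\<close>.\<close>
    have *: "n ^ (l + 1) * ((x choose (ls ! t)) * (y choose (ls ! Suc t))) \<le> d * G * n ^ (ls ! t + ls ! Suc t)"
    proof -
      have "ls ! t = l \<or> ls ! Suc t = l" using adj t by simp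
      then show ?thesis
      proof
        assume t: "ls ! t = l"
        have "(x choose l) \<le> x * (x choose (l - 1))" using l by (intro binomial_le_times) simp
        also have "\<dots> \<le> d * (x choose (l - 1))" using d by (intro mult_right_mono) auto
        finally have "(x choose l) * y \<le> d * (y * (x choose (l - 1)))"
          using mult_right_mono[of "x choose l" _ y] by (simp add: algebra_simps)
        also have "\<dots> \<le> d * G" using Gy by simp
        finally have 1: "(x choose l) * y \<le> d * G" .
        have "n ^ (l + 1) * ((x choose l) * (y choose (ls ! Suc t)))
            = n ^ l * (x choose l) * ((y choose (ls ! Suc t)) * n)" by simp
        also have "\<dots> \<le> n ^ l * (x choose l) * (y * n ^ (ls ! Suc t))"
          using pos' size by (intro mult_left_mono binomial_le_linear_pow) auto
        also have "\<dots> = (x choose l) * y * n ^ (l + ls ! Suc t)" by (simp add: power_add)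
        also have "\<dots> \<le> d * G * n ^ (l + ls ! Suc t)" using 1 by (intro mult_right_mono) auto
        finally show ?thesis using t by simp
      next
        assume t: "ls ! Suc t = l"
        have "(y choose l) \<le> y * (y choose (l - 1))" using l by (intro binomial_le_times) simp
        also have "\<dots> \<le> d * (y choose (l - 1))" using d by (intro mult_right_mono) auto
        finally have "(y choose l) * x \<le> d * (x * (y choose (l - 1)))"
          using mult_right_mono[of "y choose l" _ x] by (simp add: algebra_simps)
        also have "\<dots> \<le> d * G" using Gx by simp
        finally have 1: "(y choose l) * x \<le> d * G" .
        have "n ^ (l + 1) * ((x choose (ls ! t)) * (y choose l))
            = n ^ l * (y choose l) * ((x choose (ls ! t)) * n)" by simp
        also have "\<dots> \<le> n ^ l * (y choose l) * (x * n ^ (ls ! t))"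
          using pos' size by (intro mult_left_mono binomial_le_linear_pow) auto
        also have "\<dots> = (y choose l) * x * n ^ (ls ! t + l)" by (simp add: power_add)
        also have "\<dots> \<le> d * G * n ^ (ls ! t + l)" using 1 by (intro mult_right_mono) auto
        finally show ?thesis using t by simp
      qed
    qed
    have "n ^ (l + 1) * ?T t
       = (n ^ (l + 1) * ((x choose (ls ! t)) * (y choose (ls ! Suc t)))) * (?L t * ?R (Suc (Suc t)))"
      by simp
    also have "\<dots> \<le> (d * G * n ^ (ls ! t + ls ! Suc t)) *
        (n ^ sum_list (take t ls) * n ^ sum_list (drop (Suc (Suc t)) ls))"
      by (intro mult_mono * LR) auto
    also have "\<dots> = d * G * n ^ ?m" unfolding m by (simp add: power_add)
    finally show ?thesis .
  qed
  have "n ^ (l + 1) * (\<Sum>t<?k - 1. ?T t) = (\<Sum>t<?k - 1. n ^ (l + 1) * ?T t)"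
    by (rule sum_distrib_left)
  also have "\<dots> \<le> (\<Sum>t<?k - 1. d * G * n ^ ?m)" using T by (intro sum_mono) auto
  also have "\<dots> \<le> ?k * d * n ^ ?m * G" by (simp add: algebra_simps)
  finally have loss: "n ^ (l + 1) * (\<Sum>t<?k - 1. ?T t) \<le> ?k * d * n ^ ?m * G" .
  let ?U = "\<lambda>t. ?L t * ((x choose (ls ! t)) + (y choose (ls ! t))) * ?R (Suc t)"
  let ?V = "\<lambda>t. ?L t * (x + y choose (ls ! t)) * ?R (Suc t)"
  have "(\<Sum>t<?k. ?U t) + ?L p * ?R (Suc p) * G = (\<Sum>t<?k. ?U t + (if t = p then ?L p * ?R (Suc p) * G else 0))"
    using p by (simp add: sum.distrib)
  also have "\<dots> \<le> (\<Sum>t<?k. ?V t)"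
  proof (rule sum_mono)
    fix t assume "t \<in> {..<?k}"
    then have "1 \<le> ls ! t" using pos by auto
    then have "(x choose (ls ! t)) + (y choose (ls ! t)) \<le> (x + y choose (ls ! t))"
      by (rule binomial_superadd)
    then have "?U t \<le> ?V t" by (intro mult_mono) auto
    moreover have "?U p + ?L p * ?R (Suc p) * G = ?V p" using p G by (simp add: algebra_simps)
    ultimately show "?U t + (if t = p then ?L p * ?R (Suc p) * G else 0) \<le> ?V t" by auto
  qed
  finally have V: "(\<Sum>t<?k. ?U t) + ?L p * ?R (Suc p) * G \<le> (\<Sum>t<?k. ?V t)" .
  have n: "0 < n ^ (l + 1)" using d size by simp
  have le: "occ ls (A @ x # y # B) \<le> occ ls (A @ (x + y) # B)"
    and less: "0 < G \<Longrightarrow> occ ls (A @ x # y # B) < occ ls (A @ (x + y) # B)"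
  proof -
    have 1: "(\<Sum>t<?k - 1. ?T t) \<le> ?L p * ?R (Suc p) * G \<and> (0 < G \<longrightarrow> (\<Sum>t<?k - 1. ?T t) < ?L p * ?R (Suc p) * G)"
    proof (cases "G = 0")
      \<comment> \<open>Here \<open>loss\<close> forces the lost sum to be \<open>0\<close>, so a
        merger whose total size is still below \<open>l\<close> costs nothing.\<close>
      case True
      then show ?thesis using loss n by simp
    next
      case False
      have "n ^ (l + 1) * (\<Sum>t<?k - 1. ?T t) < ?L p * ?R (Suc p) * n ^ (l + 1) * G"
        by (rule le_less_trans[OF loss]) (use gain False in auto)
      also have "\<dots> = n ^ (l + 1) * (?L p * ?R (Suc p) * G)" by simp
      finally have "(\<Sum>t<?k - 1. ?T t) < ?L p * ?R (Suc p) * G"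
        by (simp only: mult_less_cancel1)
      then show ?thesis by simp
    qed
    show ?le and "0 < G \<Longrightarrow> occ ls (A @ x # y # B) < occ ls (A @ (x + y) # B)"
      unfolding occ_pair[of ls A x y B] occ_mid[of ls A "x + y" B] using 1 V by linarith+
  qed
  show ?le by (rule le)
  assume "l \<le> x + y"
  then have "0 < G" using binomial_superadd_strict[of l x y] l d by (simp add: G_def)
  then show "occ ls (A @ x # y # B) < occ ls (A @ (x + y) # B)" by (rule less)
qed

text \<open>The layers of \<open>zs\<close> are absorbed into \<open>x\<close> one at a time. Each
  step is weakly increasing, and the last one is strict because the total size is then at least
  \<open>l\<close>.\<close>

lemma merge_many:
  assumes pos: "\<forall>l\<in>set ls. 1 \<le> l" and l: "2 \<le> l"
    and adj: "\<And>i. Suc i < length ls \<Longrightarrow> ls ! i = l \<or> ls ! Suc i = l"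
    and p: "p < length ls" "ls ! p = l"
    and gain: "length ls * d * n ^ sum_list ls
       < occ (take p ls) A * occ (drop (Suc p) ls) B * n ^ (l + 1)"
    and "sum_list A + x + sum_list zs + sum_list B \<le> n" "zs \<noteq> []" "\<forall>z\<in>set zs. 1 \<le> z" "1 \<le> x"
    and "l \<le> x + sum_list zs" "x + sum_list zs \<le> d"
  shows "occ ls (A @ x # zs @ B) < occ ls (A @ (x + sum_list zs) # B)"
  using assms(7-)
proof (induction zs arbitrary: x)
  case (Cons z zs)
  \<comment> \<open>Layers not yet merged count as part of the right-hand host, which can only
    increase the gain.\<close>
  have gain': "length ls * d * n ^ sum_list ls
       < occ (take p ls) A * occ (drop (Suc p) ls) (zs @ B) * n ^ (l + 1)"
    using gain by (rule less_le_trans) (intro mult_mono occ_append_right, auto)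
  show ?case
  proof (cases "zs = []")
    case True
    then show ?thesis using merge_pair(2)[OF pos l adj _ p _ _ _ _ gain, of x z] Cons.prems by simp
  next
    case False
    have "occ ls (A @ x # z # zs @ B) \<le> occ ls (A @ (x + z) # zs @ B)"
      using Cons.prems by (intro merge_pair(1)[OF pos l adj _ p _ _ _ _ gain']) auto
    also have "\<dots> < occ ls (A @ (x + z + sum_list zs) # B)"
      using Cons.prems False by (intro Cons.IH) auto
    finally show ?thesis by (simp add: add.assoc)
  qed
qed simp

section \<open>Growth of the maximum\<close>

text \<open>Lists with entries \<open>0\<close> take part, so a layer of size 1 may lose its point.
  The index set is infinite, but the values stay below a power of \<open>n\<close>.\<close>

definition max_occ :: "nat list \<Rightarrow> nat \<Rightarrow> nat" where
  "max_occ ls n = Max (occ ls ` {as. sum_list as = n})"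

lemma max_occ:
  assumes "\<forall>l\<in>set ls. 1 \<le> l"
  shows occ_le_max_occ: "\<And>as. sum_list as = n \<Longrightarrow> occ ls as \<le> max_occ ls n"
    and ex_max_occ: "\<exists>as. sum_list as = n \<and> occ ls as = max_occ ls n"
proof -
  have "occ ls ` {as. sum_list as = n} \<subseteq> {.. n ^ sum_list ls}"
    using assms by (auto intro: occ_le_power)
  then have fin: "finite (occ ls ` {as. sum_list as = n})" by (rule finite_subset) simp
  have "[n] \<in> {as. sum_list as = n}" by simp
  then have ne: "occ ls ` {as. sum_list as = n} \<noteq> {}" by blast
  show "\<And>as. sum_list as = n \<Longrightarrow> occ ls as \<le> max_occ ls n"
    unfolding max_occ_def using fin by (intro Max_ge) auto
  show "\<exists>as. sum_list as = n \<and> occ ls as = max_occ ls n"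
    using Max_in[OF fin ne] unfolding max_occ_def by auto
qed

lemma sum_list_Suc_update: "j < length as \<Longrightarrow> sum_list (as[j := Suc (as ! j)]) = Suc (sum_list as)"
  by (simp add: sum_list_update member_le_sum_list)

text \<open>Applies the average of \<open>weighted_enlarge\<close> to a maximiser; each enlarged
  host is a competitor for \<open>Suc n\<close>.\<close>

lemma max_occ_growth:
  assumes "\<forall>l\<in>set ls. 1 \<le> l"
  shows "(n + sum_list ls) * max_occ ls n \<le> n * max_occ ls (Suc n)"
proof -
  obtain as where as: "sum_list as = n" "occ ls as = max_occ ls n" using ex_max_occ[OF assms] by blast
  have "(n + sum_list ls) * max_occ ls n \<le> (\<Sum>j<length as. as ! j * occ ls (as[j := Suc (as ! j)]))"
    using weighted_enlarge[of as ls] as by simp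
  also have "\<dots> \<le> (\<Sum>j<length as. as ! j * max_occ ls (Suc n))"
    using as by (intro sum_mono mult_left_mono occ_le_max_occ[OF assms]) (auto simp: sum_list_Suc_update)
  also have "\<dots> = n * max_occ ls (Suc n)"
    using as by (simp add: sum_distrib_right[symmetric] sum_list_sum_nth atLeast0LessThan)
  finally show ?thesis .
qed

text \<open>The ratio of \<open>max_occ ls n\<close> to \<open>pochhammer n m\<close>, with
  \<open>m = sum_list ls\<close>, does not decrease, since the rising factorial grows exactly by the
  factor \<open>(n + m) / n\<close> of \<open>max_occ_growth\<close>. The start is
  \<open>n = m\<close>, where the pattern occurs in itself.\<close>

lemma max_occ_lower:
  assumes pos: "\<forall>l\<in>set ls. 1 \<le> l" and n: "sum_list ls \<le> n"
  shows "n ^ sum_list ls \<le> pochhammer (sum_list ls) (sum_list ls) * max_occ ls n"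
proof (cases "ls = []")
  case True
  then show ?thesis using occ_le_max_occ[of "[]" "[n]" n] by simp
next
  case False
  let ?m = "sum_list ls"
  have m: "0 < ?m" using pos False by (cases ls) auto
  have "n ^ ?m = (\<Prod>i = 0..<?m. n)" by simp
  also have "\<dots> \<le> (\<Prod>i = 0..<?m. n + i)" by (intro prod_mono) auto
  also have "\<dots> = pochhammer n ?m" by (simp add: pochhammer_prod)
  also have "\<dots> \<le> pochhammer ?m ?m * max_occ ls n" using n
  proof (induction n rule: dec_induct)
    case base
    have "1 \<le> max_occ ls ?m"
      using order_trans[OF occ_self occ_le_max_occ[OF pos refl]] .
    then show ?case by simp
  next
    case (step n)
    have "n * pochhammer (Suc n) ?m = pochhammer n ?m * (n + ?m)"
      using pochhammer_rec[of n ?m] pochhammer_Suc[of n ?m] by simp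
    also have "\<dots> \<le> (pochhammer ?m ?m * max_occ ls n) * (n + ?m)"
      using step by (intro mult_right_mono) auto
    also have "\<dots> \<le> pochhammer ?m ?m * (n * max_occ ls (Suc n))"
      using mult_left_mono[OF max_occ_growth[OF pos, of n], of "pochhammer ?m ?m"]
      by (simp add: algebra_simps)
    finally have "n * pochhammer (Suc n) ?m \<le> n * (pochhammer ?m ?m * max_occ ls (Suc n))"
      by (simp add: algebra_simps)
    then show ?case using step m by simp
  qed
  finally show ?thesis .
qed

text \<open>Deleting a point of layer \<open>x\<close> destroys \<open>D\<close> occurrences, and
  the rest is at most the maximum for \<open>n - 1\<close>. By \<open>max_occ_growth\<close>,
  \<open>D\<close> is at least a constant times the maximum divided by \<open>n\<close>, and some
  pattern layer \<open>t\<close> accounts for its average share. The binomial chooses the other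
  points of layer \<open>t\<close>.\<close>

lemma heavy_point:
  assumes pos: "\<forall>l\<in>set ls. 1 \<le> l" and m: "1 \<le> sum_list ls" "sum_list ls \<le> n"
    and opt: "sum_list (A @ x # B) = n" "occ ls (A @ x # B) = max_occ ls n" and x: "1 \<le> x"
  shows "\<exists>t<length ls. n ^ sum_list ls \<le> 2 * pochhammer (sum_list ls) (sum_list ls) * length ls *
      (n * (occ (take t ls) A * (x - 1 choose (ls ! t - 1)) * occ (drop (Suc t) ls) B))"
proof -
  let ?m = "sum_list ls" and ?c = "pochhammer (sum_list ls) (sum_list ls) :: nat"
  let ?T = "\<lambda>t. occ (take t ls) A * (x - 1 choose (ls ! t - 1)) * occ (drop (Suc t) ls) B"
  define D where "D = (\<Sum>t<length ls. ?T t)"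
  have bin: "(x choose (ls ! t)) = (x - 1 choose (ls ! t)) + (x - 1 choose (ls ! t - 1))"
    if "t < length ls" for t
    using x pos that by (subst choose_reduce_nat) (auto simp: Suc_le_eq)
  have "(\<Sum>t<length ls. occ (take t ls) A * (x choose (ls ! t)) * occ (drop (Suc t) ls) B)
     = (\<Sum>t<length ls. occ (take t ls) A * (x - 1 choose (ls ! t)) * occ (drop (Suc t) ls) B + ?T t)"
    by (intro sum.cong refl) (simp only: bin lessThan_iff distrib_left distrib_right)
  then have D: "occ ls (A @ x # B) = occ ls (A @ (x - 1) # B) + D"
    unfolding occ_mid D_def sum.distrib by simp
  have "sum_list (A @ (x - 1) # B) = n - 1" using opt x by simp
  then have "occ ls (A @ (x - 1) # B) \<le> max_occ ls (n - 1)" by (rule occ_le_max_occ[OF pos])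
  then have "(n - 1 + ?m) * max_occ ls n \<le> (n - 1 + ?m) * max_occ ls (n - 1) + (n - 1 + ?m) * D"
    using D opt(2) by (metis add_mono_thms_linordered_semiring(3) distrib_left mult_le_mono2)
  also have "(n - 1 + ?m) * max_occ ls (n - 1) \<le> (n - 1) * max_occ ls n"
    using max_occ_growth[OF pos, of "n - 1"] m by simp
  finally have "?m * max_occ ls n \<le> (n - 1 + ?m) * D" by (simp add: distrib_right)
  \<comment> \<open>The factor 2 comes from \<open>sum_list ls \<le> n\<close>.\<close>
  also have "\<dots> \<le> 2 * n * D" using m by (intro mult_right_mono) auto
  finally have MD: "?m * max_occ ls n \<le> 2 * n * D" .
  have "n ^ ?m \<le> ?c * max_occ ls n" by (rule max_occ_lower[OF pos m(2)])
  also have "\<dots> \<le> ?c * (?m * max_occ ls n)" using m by (intro mult_left_mono) auto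
  also have "\<dots> \<le> ?c * (2 * n * D)" using MD by (intro mult_left_mono) auto
  finally have nD: "n ^ ?m \<le> ?c * (2 * n * D)" .
  have "\<exists>t<length ls. D \<le> length ls * ?T t"
  proof (rule ccontr)
    assume "\<not> ?thesis"
    then have less: "\<And>t. t < length ls \<Longrightarrow> length ls * ?T t < D" by (simp add: not_le)
    have "ls \<noteq> []" using m by auto
    then have "(\<Sum>t<length ls. length ls * ?T t) < (\<Sum>t<length ls. D)"
      by (intro sum_strict_mono less) auto
    then show False by (simp add: D_def sum_distrib_left[symmetric])
  qed
  then obtain t where t: "t < length ls" "D \<le> length ls * ?T t" by blast
  have "?c * (2 * n * D) \<le> ?c * (2 * n * (length ls * ?T t))"
    using t by (intro mult_left_mono) auto
  with nD have "n ^ ?m \<le> ?c * (2 * n * (length ls * ?T t))" by (rule order_trans)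
  then show ?thesis using t(1) by (intro exI[of _ t] conjI) (simp_all only: mult_ac)
qed

section \<open>Long segments\<close>

text \<open>The constant \<open>c\<close> is the reciprocal of the one in
  \<open>heavy_point\<close>. If the layer \<open>t\<close> found there had size at least 2, its
  binomial would contribute a factor \<open>x - 1\<close> in place of some \<open>n\<close>, forcing
  \<open>c * n \<le> x - 1\<close>. For size 1 the binomial is \<open>1\<close>, so the product of
  the two outer counts has density at least \<open>c\<close>; each has density at most 1, hence each
  has density at least \<open>c\<close>.\<close>

lemma linear_size_or_unit_layer:
  fixes c :: real and n x :: nat
  assumes pos: "\<forall>l\<in>set ls. 1 \<le> l" and m: "1 \<le> sum_list ls" "sum_list ls \<le> n"
    and opt: "sum_list (A @ x # B) = n" "occ ls (A @ x # B) = max_occ ls n" and x: "1 \<le> x"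
  defines "c \<equiv> 1 / (2 * real (pochhammer (sum_list ls) (sum_list ls)) * real (length ls))"
  assumes small: "x < c * n"
  shows "\<exists>t<length ls. ls ! t = 1 \<and> c * n ^ sum_list (take t ls) \<le> occ (take t ls) A
           \<and> c * n ^ sum_list (drop (Suc t) ls) \<le> occ (drop (Suc t) ls) B"
proof -
  let ?m = "sum_list ls"
  let ?C = "2 * pochhammer ?m ?m * length ls"
  obtain t where t: "t < length ls" and heavy: "n ^ ?m \<le> ?C *
      (n * (occ (take t ls) A * (x - 1 choose (ls ! t - 1)) * occ (drop (Suc t) ls) B))"
    using heavy_point[OF pos m opt x] by blast
  let ?l = "ls ! t" and ?a = "sum_list (take t ls)" and ?b = "sum_list (drop (Suc t) ls)"
  let ?L = "occ (take t ls) A" and ?R = "occ (drop (Suc t) ls) B"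
  have split: "?m = ?a + ?l + ?b" using sum_list_split_nth[OF t] by simp
  have L: "?L \<le> n ^ ?a" and R: "?R \<le> n ^ ?b"
    using pos opt by (auto intro!: occ_le_power dest: in_set_takeD in_set_dropD)
  have l: "1 \<le> ?l" using pos t by simp
  have n: "0 < n" using m by simp
  have "0 < pochhammer ?m ?m" "0 < length ls" using m t by (auto intro: pochhammer_pos)
  then have "0 < ?C" by simp
  then have C: "0 < real ?C" by (simp only: of_nat_0_less_iff)
  have c: "c = 1 / real ?C" by (simp add: c_def)
  have "real (n ^ ?m) \<le> real (?C * (n * (?L * (x - 1 choose (?l - 1)) * ?R)))"
    using heavy of_nat_mono by blast
  then have cT: "c * real n ^ ?m \<le> real (n * (?L * (x - 1 choose (?l - 1)) * ?R))"
    using C unfolding c by (simp add: field_simps)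
  have "?l = 1"
  proof (rule ccontr)
    assume "?l \<noteq> 1"
    then have "(x - 1 choose (?l - 1)) * n \<le> (x - 1) * n ^ (?l - 1)"
      using l opt(1) by (intro binomial_le_linear_pow) auto
    from mult_mono[OF mult_left_mono[OF this, of n] mult_mono[OF L R]]
    have "n * ((x - 1 choose (?l - 1)) * n) * (?L * ?R) \<le> n * ((x - 1) * n ^ (?l - 1)) * (n ^ ?a * n ^ ?b)"
      by simp
    also have "\<dots> = (x - 1) * n ^ ?m"
      unfolding split using l by (cases ?l) (auto simp: power_add)
    finally have "n * (n * (?L * (x - 1 choose (?l - 1)) * ?R)) \<le> (x - 1) * n ^ ?m"
      by (simp add: algebra_simps)
    then have "real n * real (n * (?L * (x - 1 choose (?l - 1)) * ?R)) \<le> real (x - 1) * real n ^ ?m"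
      by (metis of_nat_mono of_nat_mult of_nat_power)
    moreover have "real n * (c * real n ^ ?m) \<le> real n * real (n * (?L * (x - 1 choose (?l - 1)) * ?R))"
      using cT by (intro mult_left_mono) auto
    ultimately have "(c * real n) * real n ^ ?m \<le> real (x - 1) * real n ^ ?m" by (simp add: mult_ac)
    then have "c * n \<le> real (x - 1)" using n by simp
    then show False using small by simp
  qed
  have cLR: "c * (real n ^ ?a * (real n * real n ^ ?b)) \<le> real n * (real ?L * real ?R)"
    using cT unfolding split \<open>?l = 1\<close> by (simp add: power_add mult_ac)
  then have cLR: "c * (real n ^ ?a * real n ^ ?b) \<le> real ?L * real ?R" using n by simp
  have Lr: "real ?L \<le> real n ^ ?a" and Rr: "real ?R \<le> real n ^ ?b"
    using L R by (metis of_nat_mono of_nat_power)+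
  have "(c * real n ^ ?a) * real n ^ ?b \<le> real ?L * real n ^ ?b"
    using cLR mult_left_mono[OF Rr, of "real ?L"] by (simp add: mult_ac)
  then have 1: "c * real n ^ ?a \<le> real ?L" using n by simp
  have "(c * real n ^ ?b) * real n ^ ?a \<le> real ?R * real n ^ ?a"
    using cLR mult_right_mono[OF Lr, of "real ?R"] by (simp add: mult_ac)
  then have 2: "c * real n ^ ?b \<le> real ?R" using n by simp
  show ?thesis using t \<open>?l = 1\<close> 1 2 by auto
qed

text \<open>If the \<open>l\<close> layers \<open>x # zs\<close> were too light, merging them would
  beat the maximum. The remaining mass of \<open>J\<close> can host the unit layer \<open>t\<close>,
  which frees the merged layer for a neighbour of \<open>t\<close> of size \<open>l\<close>.\<close>

lemma window_mass:
  fixes c :: real and n l x :: nat and J zs :: "nat list"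
  assumes pos: "\<forall>l\<in>set ls. 1 \<le> l" and l: "2 \<le> l"
    and adj: "\<And>i. Suc i < length ls \<Longrightarrow> ls ! i = l \<or> ls ! Suc i = l"
    and t: "1 \<le> t" "Suc t < length ls" "ls ! t = 1"
    and c: "0 < c" "c \<le> 1"
    and L: "c * n ^ sum_list (take t ls) \<le> occ (take t ls) A"
    and R: "c * n ^ sum_list (drop (Suc t) ls) \<le> occ (drop (Suc t) ls) B"
    and opt: "sum_list (A @ J @ B) = n" "occ ls (A @ J @ B) = max_occ ls n"
    and J: "J = J1 @ x # zs @ J2" "length zs = l - 1" "\<forall>z\<in>set J. 1 \<le> z"
  shows "c\<^sup>2 / (8 * real (length ls)) * sum_list J < x + sum_list zs"
proof (rule ccontr)
  define w s k where "w = x + sum_list zs" and "s = sum_list J" and "k = real (length ls)"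
  let ?m = "sum_list ls" and ?a = "sum_list (take t ls)" and ?b = "sum_list (drop (Suc t) ls)"
  assume "\<not> c\<^sup>2 / (8 * real (length ls)) * sum_list J < x + sum_list zs"
  then have w: "w \<le> c\<^sup>2 / (8 * k) * s" by (simp add: w_def s_def k_def)
  have k: "1 \<le> k" using t by (simp add: k_def)
  have kw: "k * w \<le> c\<^sup>2 / 8 * s" using mult_left_mono[OF w, of k] k by simp
  have s: "0 < s" using J by (auto simp: s_def)
  have n: "s \<le> n" "0 < n" using opt s by (auto simp: s_def)
  have "real w \<le> k * w" using k by (simp add: mult_le_cancel_right1)
  also have "\<dots> \<le> 1 / 8 * s" using kw c power_le_one[of c 2]
    by (intro order_trans[OF kw] mult_right_mono) auto
  finally have "s \<le> 2 * (sum_list J1 + sum_list J2)" using J by (simp add: s_def w_def)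
  then have "real s \<le> real (2 * (sum_list J1 + sum_list J2))" by (simp only: of_nat_le_iff)
  \<comment> \<open>A light window leaves at least half of the mass outside, so one side holds a
    quarter.\<close>
  then have half: "real s / 4 \<le> sum_list J1 \<or> real s / 4 \<le> sum_list J2" by auto
  have m: "?m = ?a + 1 + ?b" using sum_list_split_nth[of t ls] t by simp
  have ls_t: "ls ! (t - 1) = l" "ls ! Suc t = l" using adj[of "t - 1"] adj[of t] t l by auto
  have single: "occ [l] C \<le> n ^ l" if "sum_list C \<le> n" for C
    using occ_le_power[of "[l]" C n] that l by simp
  have "\<exists>p<length ls. ls ! p = l \<and>
      (c * n ^ ?a) * (real s / 4) * (c * n ^ ?b) * n
        \<le> real (occ (take p ls) (A @ J1)) * occ (drop (Suc p) ls) (J2 @ B) * n ^ (l + 1)"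
    using half
  proof
    \<comment> \<open>Layer \<open>t - 1\<close> goes to the window and layer \<open>t\<close> to a
      point of \<open>J2\<close>. Dropping layer \<open>t - 1\<close> from the left pattern costs at
      most the factor \<open>n ^ l\<close>.\<close>
    assume half: "real s / 4 \<le> sum_list J2"
    define p where "p = t - 1"
    have p: "t = Suc p" using t by (simp add: p_def)
    have "occ (take t ls) A = occ (take p ls @ [l]) A"
      using p ls_t t by (simp add: take_Suc_conv_app_nth)
    also have "\<dots> \<le> occ (take p ls) A * occ [l] A" by (rule occ_pattern_append_le)
    also have "\<dots> \<le> occ (take p ls) (A @ J1) * n ^ l"
      using opt by (intro mult_mono occ_append_left single) auto
    finally have "real (occ (take t ls) A) \<le> real (occ (take p ls) (A @ J1)) * n ^ l"
      by (metis of_nat_mono of_nat_mult of_nat_power)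
    with L have 1: "c * n ^ ?a \<le> real (occ (take p ls) (A @ J1)) * n ^ l" by linarith
    have "sum_list J2 * occ (drop (Suc t) ls) B \<le> occ ([1] @ drop (Suc t) ls) (J2 @ B)"
      using occ_mult_le_append[of "[1]" J2] by (simp only: occ_single)
    also have "[1] @ drop (Suc t) ls = drop (Suc p) ls" using p t by (simp add: Cons_nth_drop_Suc[symmetric])
    finally have "real (sum_list J2) * occ (drop (Suc t) ls) B \<le> occ (drop (Suc p) ls) (J2 @ B)"
      by (metis of_nat_mono of_nat_mult)
    moreover have "real s / 4 * (c * n ^ ?b) \<le> real (sum_list J2) * occ (drop (Suc t) ls) B"
      using half R c by (intro mult_mono) auto
    ultimately have 2: "real s / 4 * (c * n ^ ?b) \<le> occ (drop (Suc p) ls) (J2 @ B)" by linarith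
    have "(c * n ^ ?a) * (real s / 4 * (c * n ^ ?b)) * n
       \<le> (real (occ (take p ls) (A @ J1)) * n ^ l) * occ (drop (Suc p) ls) (J2 @ B) * n"
      by (rule mult_right_mono[OF mult_mono]) (use 1 2 c in auto)
    then show ?thesis using p t ls_t by (intro exI[of _ p]) (auto simp: mult_ac)
  next
    \<comment> \<open>Symmetrically, layer \<open>t\<close> goes to a point of \<open>J1\<close> and
      layer \<open>Suc t\<close> to the window.\<close>
    assume half: "real s / 4 \<le> sum_list J1"
    have "occ (drop (Suc t) ls) B = occ ([l] @ drop (Suc (Suc t)) ls) B"
      using ls_t t by (simp add: Cons_nth_drop_Suc[symmetric])
    also have "\<dots> \<le> occ [l] B * occ (drop (Suc (Suc t)) ls) B" by (rule occ_pattern_append_le)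
    also have "\<dots> \<le> n ^ l * occ (drop (Suc (Suc t)) ls) (J2 @ B)"
      using opt by (intro mult_mono occ_append_right single) auto
    finally have "real (occ (drop (Suc t) ls) B) \<le> n ^ l * real (occ (drop (Suc (Suc t)) ls) (J2 @ B))"
      by (metis of_nat_mono of_nat_mult of_nat_power)
    with R have 1: "c * n ^ ?b \<le> n ^ l * real (occ (drop (Suc (Suc t)) ls) (J2 @ B))" by linarith
    have "occ (take t ls) A * sum_list J1 \<le> occ (take t ls @ [1]) (A @ J1)"
      using occ_mult_le_append[of "take t ls" A "[1]" J1] by (simp only: occ_single)
    also have "take t ls @ [1] = take (Suc t) ls" using t by (simp add: take_Suc_conv_app_nth)
    finally have "real (occ (take t ls) A) * sum_list J1 \<le> occ (take (Suc t) ls) (A @ J1)"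
      by (metis of_nat_mono of_nat_mult)
    moreover have "c * n ^ ?a * (real s / 4) \<le> real (occ (take t ls) A) * sum_list J1"
      using half L c by (intro mult_mono) auto
    ultimately have 2: "c * n ^ ?a * (real s / 4) \<le> occ (take (Suc t) ls) (A @ J1)" by linarith
    have "(c * n ^ ?a * (real s / 4)) * (c * n ^ ?b) * n
       \<le> occ (take (Suc t) ls) (A @ J1) * (n ^ l * real (occ (drop (Suc (Suc t)) ls) (J2 @ B))) * n"
      by (rule mult_right_mono[OF mult_mono]) (use 1 2 c in auto)
    then show ?thesis using t ls_t by (intro exI[of _ "Suc t"]) (auto simp: mult_ac)
  qed
  then obtain p where p: "p < length ls" "ls ! p = l" and
    gain: "(c * n ^ ?a) * (real s / 4) * (c * n ^ ?b) * n
        \<le> real (occ (take p ls) (A @ J1)) * occ (drop (Suc p) ls) (J2 @ B) * n ^ (l + 1)" by blast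
  \<comment> \<open>The gap between \<open>1 / 8\<close> and \<open>1 / 4\<close> gives the strict
    inequality required by \<open>merge_many\<close> with \<open>d = w\<close>.\<close>
  have "k * w * n ^ ?m \<le> c\<^sup>2 / 8 * s * n ^ ?m" using kw by (intro mult_right_mono) auto
  also have "\<dots> < c\<^sup>2 / 4 * s * n ^ ?m" using c s n by (intro mult_strict_right_mono) auto
  also have "\<dots> = (c * n ^ ?a) * (real s / 4) * (c * n ^ ?b) * n"
    unfolding m by (simp add: power_add power2_eq_square)
  also note gain
  finally have "real (length ls * w * n ^ ?m)
      < real (occ (take p ls) (A @ J1) * occ (drop (Suc p) ls) (J2 @ B) * n ^ (l + 1))"
    by (simp add: k_def)
  then have "length ls * w * n ^ ?m
      < occ (take p ls) (A @ J1) * occ (drop (Suc p) ls) (J2 @ B) * n ^ (l + 1)"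
    by (simp only: of_nat_less_iff)
  moreover have "length zs \<le> sum_list zs" using J sum_list_mono[of zs "\<lambda>_. 1" "\<lambda>z. z"]
    by (simp add: sum_list_triv)
  ultimately have "occ ls ((A @ J1) @ x # zs @ J2 @ B) < occ ls ((A @ J1) @ w # J2 @ B)"
    unfolding w_def using J opt l by (intro merge_many[OF pos l adj p, where n = n and d = w]) (auto simp: w_def)
  also have "\<dots> \<le> max_occ ls n" using opt J by (intro occ_le_max_occ[OF pos]) (auto simp: w_def)
  finally show False using opt J by simp
qed

text \<open>Windows are cut off from the left; an incomplete remainder is discarded.\<close>

lemma sum_list_windows:
  fixes D :: real and J :: "nat list"
  assumes "0 < q" "\<And>J1 W J2. J = J1 @ W @ J2 \<Longrightarrow> length W = q \<Longrightarrow> D \<le> sum_list W"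
  shows "real (length J div q) * D \<le> sum_list J"
  using assms(2)
proof (induction "length J" arbitrary: J rule: less_induct)
  case less
  show ?case
  proof (cases "length J < q")
    case False
    have "real (length (drop q J) div q) * D \<le> sum_list (drop q J)"
    proof (rule less.hyps)
      fix J1 W J2 assume drop: "drop q J = J1 @ W @ J2" and W: "length W = q"
      have "J = (take q J @ J1) @ W @ J2"
        using append_take_drop_id[of q J] unfolding drop by simp
      then show "D \<le> sum_list W" using W by (rule less.prems)
    qed (use assms(1) False in auto)
    moreover have "D \<le> sum_list (take q J)"
      using less.prems[of "[]" "take q J" "drop q J"] False by simp
    moreover have "sum_list J = sum_list (take q J) + sum_list (drop q J)"
      using sum_list_append[of "take q J" "drop q J"] by simp
    moreover have "length J div q = Suc (length (drop q J) div q)"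
      using False assms(1) by (simp add: le_div_geq)
    ultimately show ?thesis by (simp add: algebra_simps)
  qed simp
qed

text \<open>Disjoint windows of \<open>l\<close> layers each carry a fixed fraction of the mass of
  \<open>J\<close>, so their number is at most \<open>8 * length ls / c\<^sup>2\<close>.\<close>

lemma segment_length:
  fixes c :: real and n l :: nat and J :: "nat list"
  assumes pos: "\<forall>l\<in>set ls. 1 \<le> l" and l: "2 \<le> l"
    and adj: "\<And>i. Suc i < length ls \<Longrightarrow> ls ! i = l \<or> ls ! Suc i = l"
    and t: "1 \<le> t" "Suc t < length ls" "ls ! t = 1"
    and c: "0 < c" "c \<le> 1"
    and L: "c * n ^ sum_list (take t ls) \<le> occ (take t ls) A"
    and R: "c * n ^ sum_list (drop (Suc t) ls) \<le> occ (drop (Suc t) ls) B"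
    and opt: "sum_list (A @ J @ B) = n" "occ ls (A @ J @ B) = max_occ ls n"
    and J: "\<forall>z\<in>set J. 1 \<le> z" "J \<noteq> []"
  shows "length J \<le> l * (8 * real (length ls) / c\<^sup>2 + 1)"
proof -
  define k s where "k = real (length ls)" and "s = real (sum_list J)"
  have s: "0 < s" using J by (cases J) (auto simp: s_def)
  have k: "0 < k" using t by (auto simp: k_def)
  have "real (length J div l) * (c\<^sup>2 / (8 * k) * s) \<le> s" unfolding s_def k_def
  proof (rule sum_list_windows)
    fix J1 W J2 assume W: "J = J1 @ W @ J2" "length W = l"
    then obtain x zs where x: "W = x # zs" using l by (cases W) auto
    have "c\<^sup>2 / (8 * real (length ls)) * sum_list J < x + sum_list zs"
      using W x J by (intro window_mass[OF pos l adj t c L R opt]) auto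
    then show "c\<^sup>2 / (8 * real (length ls)) * sum_list J \<le> sum_list W" using x by simp
  qed (use l in simp)
  then have "(real (length J div l) * (c\<^sup>2 / (8 * k))) * s \<le> 1 * s" by (simp add: mult_ac)
  then have "real (length J div l) * (c\<^sup>2 / (8 * k)) \<le> 1"
    by (rule mult_right_le_imp_le[OF _ s])
  then have "real (length J div l) \<le> 8 * k / c\<^sup>2" using k c by (simp add: field_simps)
  moreover have len: "length J \<le> l * (length J div l + 1)"
  proof -
    have "length J = l * (length J div l) + length J mod l" by simp
    moreover have "length J mod l < l" using l by simp
    ultimately show ?thesis unfolding distrib_left mult_1_right by linarith
  qed
  ultimately have "real l * (real (length J div l) + 1) \<le> l * (8 * k / c\<^sup>2 + 1)"
    using l by (intro mult_left_mono) auto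
  moreover have "real (length J) \<le> real (l * (length J div l + 1))"
    by (rule of_nat_mono[OF len])
  ultimately show ?thesis by (simp add: k_def algebra_simps)
qed

lemma card_le_of_span:
  assumes "\<And>i j. i \<in> S \<Longrightarrow> j \<in> S \<Longrightarrow> i \<le> j \<Longrightarrow> real (Suc j - i) \<le> M" "0 \<le> M" "finite S"
  shows "real (card S) \<le> M"
proof (cases "S = {}")
  case False
  have "S \<subseteq> {Min S..Max S}" using assms by auto
  then have "card S \<le> Suc (Max S) - Min S" using card_mono[of "{Min S..Max S}" S] by simp
  also have "real \<dots> \<le> M" using assms False by (intro assms(1)) auto
  finally show ?thesis by simp
qed (use assms in simp)

text \<open>Layers of size at least \<open>c * n\<close> number at most \<open>1 / c\<close>. Every
  other position lies in a set \<open>?S t\<close> given by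
  \<open>linear_size_or_unit_layer\<close>, and each such set spans a segment of bounded
  length.\<close>

lemma layer_count:
  fixes c :: real and n l :: nat and as :: "nat list"
  assumes pos: "\<forall>l\<in>set ls. 1 \<le> l" and l: "2 \<le> l" "ls \<noteq> []" "hd ls = l" "last ls = l"
    and adj: "\<And>i. Suc i < length ls \<Longrightarrow> ls ! i = l \<or> ls ! Suc i = l"
    and n: "sum_list ls \<le> n"
    and opt: "sum_list as = n" "occ ls as = max_occ ls n" and as: "\<forall>a\<in>set as. 1 \<le> a"
  defines "c \<equiv> 1 / (2 * real (pochhammer (sum_list ls) (sum_list ls)) * real (length ls))"
  shows "length as \<le> 1 / c + length ls * (l * (8 * real (length ls) / c\<^sup>2 + 1))"
proof -
  let ?m = "sum_list ls" and ?k = "length ls"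
  define M where "M = l * (8 * real ?k / c\<^sup>2 + 1)"
  have m: "1 \<le> ?m" using pos l(2) by (cases ls) auto
  have C: "1 \<le> 2 * pochhammer ?m ?m * ?k"
    using m l(2) pochhammer_pos[of ?m ?m] by (simp add: Suc_le_eq)
  then have C: "1 \<le> real (2 * pochhammer ?m ?m * ?k)" by linarith
  have "0 < 1 / r \<and> 1 / r \<le> 1" if "1 \<le> r" for r :: real using that by simp
  from this[OF C] have c: "0 < c" "c \<le> 1" by (simp_all add: c_def)
  have M: "0 \<le> M" by (simp add: M_def)
  let ?S = "\<lambda>t. {j. j < length as \<and> ls ! t = 1 \<and>
     c * n ^ sum_list (take t ls) \<le> occ (take t ls) (take j as) \<and>
     c * n ^ sum_list (drop (Suc t) ls) \<le> occ (drop (Suc t) ls) (drop (Suc j) as)}"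
  let ?big = "{j. j < length as \<and> c * n \<le> as ! j}"
  have "j \<in> ?big \<union> (\<Union>t<?k. ?S t)" if j: "j < length as" for j
  proof (cases "c * n \<le> as ! j")
    case False
    have split: "as = take j as @ as ! j # drop (Suc j) as" using j by (rule id_take_nth_drop)
    have "\<exists>t<?k. ls ! t = 1 \<and> c * n ^ sum_list (take t ls) \<le> occ (take t ls) (take j as)
           \<and> c * n ^ sum_list (drop (Suc t) ls) \<le> occ (drop (Suc t) ls) (drop (Suc j) as)"
      unfolding c_def
      by (rule linear_size_or_unit_layer[OF pos m n, where x = "as ! j"])
        (use opt split as j False in \<open>auto simp: c_def\<close>)
    then show ?thesis using j by blast
  qed (use j in blast)
  then have cover: "{..<length as} \<subseteq> ?big \<union> (\<Union>t<?k. ?S t)" by blast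
  have big: "real (card ?big) \<le> 1 / c"
  proof -
    have "card ?big * (c * n) = (\<Sum>j\<in>?big. c * n)" by simp
    also have "\<dots> \<le> (\<Sum>j\<in>?big. real (as ! j))" by (intro sum_mono) auto
    also have "\<dots> \<le> (\<Sum>j<length as. real (as ! j))" by (intro sum_mono2) auto
    also have "\<dots> = real n" using opt by (simp add: sum_list_sum_nth atLeast0LessThan flip: of_nat_sum)
    finally have "(card ?big * c) * real n \<le> 1 * real n" by (simp add: mult_ac)
    then show ?thesis using m n c by (simp add: field_simps)
  qed
  have S: "real (card (?S t)) \<le> M" if t: "t < ?k" for t
  proof (rule card_le_of_span)
    fix i j assume ij: "i \<in> ?S t" "j \<in> ?S t" "i \<le> j"
    \<comment> \<open>The outer pattern layers have size \<open>l \<ge> 2\<close>, so a unit layer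
      has neighbours on both sides.\<close>
    have "ls ! 0 = l" "ls ! (?k - 1) = l" using l hd_conv_nth[of ls] last_conv_nth[of ls] by auto
    moreover have "ls ! t \<noteq> l" using ij l(1) by simp
    ultimately have "t \<noteq> 0" "t \<noteq> ?k - 1" by metis+
    then have t': "1 \<le> t" "Suc t < ?k" using t by auto
    \<comment> \<open>The left density comes from position \<open>i\<close> and the right density
      from \<open>j\<close>, so \<open>segment_length\<close> applies to everything from
      \<open>i\<close> to \<open>j\<close>.\<close>
    define J where "J = drop i (take (Suc j) as)"
    have as_split: "as = take i as @ J @ drop (Suc j) as"
      using ij by (metis J_def append.assoc append_take_drop_id le_SucI min.absorb1 take_take)
    have J: "length J = Suc j - i" "set J \<subseteq> set as"
      using ij by (auto simp: J_def dest: in_set_takeD in_set_dropD)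
    have "length J \<le> l * (8 * real ?k / c\<^sup>2 + 1)"
      by (rule segment_length[OF pos l(1) adj t' _ c, where A = "take i as" and B = "drop (Suc j) as"])
        (use ij opt as J as_split in auto)
    then show "real (Suc j - i) \<le> M" using J by (simp add: M_def)
  qed (use M in auto)
  have "length as \<le> card (?big \<union> (\<Union>t<?k. ?S t))"
    using card_mono[OF _ cover] by simp
  also have "\<dots> \<le> card ?big + card (\<Union>t<?k. ?S t)" by (rule card_Un_le)
  also have "\<dots> \<le> card ?big + (\<Sum>t<?k. card (?S t))" by (intro add_left_mono card_UN_le) simp
  finally have "real (length as) \<le> real (card ?big + (\<Sum>t<?k. card (?S t)))"
    by (rule of_nat_mono)
  also have "\<dots> = real (card ?big) + (\<Sum>t<?k. real (card (?S t)))"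
    by (simp only: of_nat_add of_nat_sum)
  also have "\<dots> \<le> 1 / c + (\<Sum>t<?k. M)" using big S by (intro add_mono sum_mono) auto
  finally show ?thesis by (simp add: M_def)
qed

theorem theorem1p6:
  fixes \<sigma> :: "nat \<Rightarrow> nat" and m :: nat and ls :: "nat list"
  assumes "layered m \<sigma> ls"
    and "length ls \<ge> 2"
    and "hd ls = last ls"
    and "hd ls \<ge> 2"
    and "\<forall>i. Suc i < length ls \<longrightarrow> ls ! i = hd ls \<or> ls ! Suc i = hd ls"
  shows "\<exists>K::nat. \<forall>n \<pi> ls'. optimal m \<sigma> n \<pi> \<and> layered n \<pi> ls' \<longrightarrow> length ls' \<le> K"
proof -
  have pos: "\<forall>l\<in>set ls. 1 \<le> l" and m: "sum_list ls = m" using assms(1) by (auto simp: layered_def)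
  have ne: "ls \<noteq> []" using assms(2) by auto
  \<comment> \<open>The bound in \<open>layer_count\<close> depends only on the pattern, so one
    \<open>K\<close> serves all \<open>n\<close> and all hosts.\<close>
  obtain K :: real where K: "\<And>n as. sum_list ls \<le> n \<Longrightarrow> sum_list as = n \<Longrightarrow> occ ls as = max_occ ls n
      \<Longrightarrow> \<forall>a\<in>set as. 1 \<le> a \<Longrightarrow> real (length as) \<le> K"
    using layer_count[OF pos assms(4) ne refl assms(3)[symmetric]] assms(5) by blast
  have "length ls' \<le> nat \<lceil>K\<rceil>" if opt: "optimal m \<sigma> n \<pi>" and lay: "layered n \<pi> ls'" for n \<pi> ls'
  proof -
    have ls': "sum_list ls' = n" "\<forall>a\<in>set ls'. 1 \<le> a" using lay by (auto simp: layered_def)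
    \<comment> \<open>The maximiser \<open>bs\<close> may contain entries \<open>0\<close>;
      \<open>optimal_layered_occ\<close> admits such competitors.\<close>
    obtain bs where bs: "sum_list bs = n" "occ ls bs = max_occ ls n" using ex_max_occ[OF pos] by blast
    have "occ ls bs \<le> occ ls ls'" by (rule optimal_layered_occ[OF assms(1) opt lay bs(1)])
    then have "occ ls ls' = max_occ ls n"
      using bs(2) occ_le_max_occ[OF pos ls'(1)] by simp
    then have "real (length ls') \<le> K"
      using K ls' opt m by (auto simp: optimal_def)
    then show ?thesis by linarith
  qed
  then show ?thesis by blast
qed

end
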